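(* Let $(L_j)_{j\ge -1}$ be nonnegative integers and let $\kappa_l^j\in\mathbb{C}$ ($j\ge -1$, $l\ge 0$) be window coefficients that are $L_j$-bandlimited, i.e. $\kappa_l^j=0$ for $l>L_j$, and that satisfy the Calderón admissibility condition $$\frac{4\pi}{2l+1}\sum_{j=-1}^{\infty}|\kappa_l^j|^2=1\qquad\text{for all } l\ge 0 .$$ For every $j\ge -1$ let $\{(\lambda_{jk},w_{jk})\}_{k\in\mathcal{K}_j}$ (with $\lambda_{jk}\in S^2$, $w_{jk}>0$) be a scalable reproducing kernel frame for $\mathcal{H}_{\le L_j}(S^2)$. Define $$\psi_{jk}(\omega)=\sum_{l=0}^{L_j}\sum_{m=-l}^{l}\sqrt{\frac{4\pi}{2l+1}}\,\sqrt{w_{jk}}\;\kappa_l^j\;y_{lm}(\lambda_{jk})\,y_{lm}(\omega),\qquad j\ge -1,\ k\in\mathcal{K}_j .$$ Then the functions $\{\psi_{jk}\}_{j\ge -1,\,k\in\mathcal{K}_j}$ form a Parseval tight frame for $L_2(S^2)$; that is, for every $f\in L_2(S^2)$, $$f=\sum_{j=-1}^{\infty}\sum_{k\in\mathcal{K}_j}\langle f,\psi_{jk}\rangle\,\psi_{jk}\quad\text{in }L_2(S^2),\qquad \|f\|_{L_2}^2=\sum_{j=-1}^{\infty}\sum_{k\in\mathcal{K}_j}|\langle f,\psi_{jk}\rangle|^2 .$$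
   Context: $S^2$ is the unit sphere with its standard area measure, $L_2(S^2)$ the space of complex-valued square integrable functions with inner product $\langle f,g\rangle=\int_{S^2}f\,\overline{g}\,d\omega$. $y_{lm}$ ($l\ge 0$, $-l\le m\le l$) are the standard complex (Legendre) spherical harmonics $y_{lm}(\theta,\phi)=C_{lm}e^{im\phi}P_{lm}(\cos\theta)$, normalized to be an orthonormal basis of $L_2(S^2)$. $\mathcal{H}_{\le L}(S^2)$ is the span of all $y_{lm}$ with $l\le L$; with the $L_2$ inner product it is a reproducing kernel Hilbert space with kernel $k_\eta(\omega)=\sum_{l=0}^{L}\sum_{m=-l}^{l}\overline{y_{lm}(\eta)}\,y_{lm}(\omega)$. A scalable reproducing kernel frame for $\mathcal{H}_{\le L}(S^2)$ is a (finite or countable) family $\{(\lambda_k,w_k)\}_{k\in\mathcal{K}}$ of locations $\lambda_k\in S^2$ and positive weights $w_k$ such that $f(\omega)=\sum_{k\in\mathcal{K}}f(\lambda_k)\,w_k\,k_{\lambda_k}(\omega)$ for all $f\in\mathcal{H}_{\le L}(S^2)$; equivalently, $\sum_{k\in\mathcal{K}}w_k\,\overline{y_{lm}(\lambda_k)}\,y_{l'm'}(\lambda_k)=\delta_{ll'}\delta_{mm'}$ for all $l,l'\le L$ and all admissible $m,m'$. *)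

theory Defs
  imports "HOL-Analysis.Analysis" "HOL-Computational_Algebra.Polynomial"
begin

section \<open>The unit sphere and its area measure\<close>

abbreviation S2 :: "(real ^ 3) set" where
  "S2 \<equiv> sphere 0 1"

definition spherical_point :: "real \<Rightarrow> real \<Rightarrow> real ^ 3" where
  "spherical_point \<theta> \<phi> = vector [sin \<theta> * cos \<phi>, sin \<theta> * sin \<phi>, cos \<theta>]"

text \<open>The area element is \<open>d\<omega> = sin \<theta> d\<theta> d\<phi>\<close>; the total mass is \<open>4 \<pi>\<close>.\<close>

definition sphere_measure :: "(real ^ 3) measure" where
  "sphere_measure =
     distr
       (density lborel
         (\<lambda>(\<theta>, \<phi>). ennreal (sin \<theta>) * indicator ({0..pi} \<times> {0..2 * pi}) (\<theta>, \<phi>)))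
       (restrict_space borel S2)
       (\<lambda>(\<theta>, \<phi>). spherical_point \<theta> \<phi>)"

definition polar_angle :: "real ^ 3 \<Rightarrow> real" where
  "polar_angle \<omega> = arccos (\<omega> $ 3)"

text \<open>At the two poles the azimuth is 0 by convention (\<open>Arg2pi 0 = 0\<close>). The spherical harmonics
  do not depend on this choice: those with nonzero order vanish at the poles.\<close>

definition azimuth :: "real ^ 3 \<Rightarrow> real" where
  "azimuth \<omega> = Arg2pi (Complex (\<omega> $ 1) (\<omega> $ 2))"


section \<open>Spherical harmonics\<close>

text \<open>Rodrigues' formula.\<close>

definition legendre_poly :: "nat \<Rightarrow> real poly" where
  "legendre_poly l = smult (1 / (2 ^ l * fact l)) ((pderiv ^^ l) ([:-1, 0, 1:] ^ l))"

text \<open>The sign \<open>(-1)^m\<close> is the Condon--Shortley phase. For negative order we use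
  \<open>P_(l,-m) = (-1)^m (l-m)!/(l+m)! P_(l,m)\<close>, which is what Rodrigues' formula
  \<open>(-1)^m / (2^l l!) (1-x^2)^(m/2) (d/dx)^(l+m) (x^2-1)^l\<close> gives for all \<open>-l \<le> m \<le> l\<close>, but does
  not divide by zero at \<open>x = \<plusminus>1\<close>.\<close>

definition assoc_legendre :: "nat \<Rightarrow> int \<Rightarrow> real \<Rightarrow> real" where
  "assoc_legendre l m x =
     (let n = nat \<bar>m\<bar>;
          p = (-1) ^ n * sqrt (1 - x\<^sup>2) ^ n * poly ((pderiv ^^ n) (legendre_poly l)) x
      in if 0 \<le> m then p else (-1) ^ n * (fact (l - n) / fact (l + n)) * p)"

definition sph_norm_const :: "nat \<Rightarrow> int \<Rightarrow> real" where
  "sph_norm_const l m =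
     sqrt ((2 * real l + 1) / (4 * pi) * (fact (nat (int l - m)) / fact (nat (int l + m))))"

text \<open>Only \<open>\<bar>m\<bar> \<le> l\<close> and arguments in \<^const>\<open>S2\<close> are meaningful.\<close>

definition sph_harm :: "nat \<Rightarrow> int \<Rightarrow> real ^ 3 \<Rightarrow> complex" where
  "sph_harm l m \<omega> =
     of_real (sph_norm_const l m) * exp (\<i> * of_int m * of_real (azimuth \<omega>)) *
     of_real (assoc_legendre l m (cos (polar_angle \<omega>)))"


section \<open>Bandlimited functions and scalable reproducing kernel frames\<close>

definition bandlimited :: "nat \<Rightarrow> (real ^ 3 \<Rightarrow> complex) set" where
  "bandlimited L =
     {f. \<exists>c :: nat \<Rightarrow> int \<Rightarrow> complex.
           f = (\<lambda>\<omega>. \<Sum>l\<le>L. \<Sum>m\<in>{- int l..int l}. c l m * sph_harm l m \<omega>)}"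

definition repr_kernel :: "nat \<Rightarrow> real ^ 3 \<Rightarrow> real ^ 3 \<Rightarrow> complex" where
  "repr_kernel L \<eta> \<omega> =
     (\<Sum>l\<le>L. \<Sum>m\<in>{- int l..int l}. cnj (sph_harm l m \<eta>) * sph_harm l m \<omega>)"

text \<open>The index set \<open>K\<close> carries no order, so the reproducing sum is an unordered one. It is
  taken pointwise; on the finite-dimensional space \<^term>\<open>bandlimited L\<close> this is the same as
  convergence in norm.\<close>

definition scalable_rk_frame ::
    "nat \<Rightarrow> 'k set \<Rightarrow> ('k \<Rightarrow> real ^ 3) \<Rightarrow> ('k \<Rightarrow> real) \<Rightarrow> bool" where
  "scalable_rk_frame L K loc w \<longleftrightarrow>
     countable K \<and>
     (\<forall>k\<in>K. loc k \<in> S2 \<and> 0 < w k) \<and>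
     (\<forall>f\<in>bandlimited L. \<forall>\<omega>\<in>S2.
        ((\<lambda>k. f (loc k) * of_real (w k) * repr_kernel L (loc k) \<omega>) has_sum f \<omega>) K)"


section \<open>Square integrable functions and Parseval tight frames\<close>

text \<open>Functions are not identified almost everywhere; equality in \<open>L\<^sub>2\<close> is expressed through the
  seminorm \<open>L2_norm\<close>.\<close>

definition L2_space :: "'a measure \<Rightarrow> ('a \<Rightarrow> complex) set" where
  "L2_space M = {f \<in> borel_measurable M. integrable M (\<lambda>x. (cmod (f x))\<^sup>2)}"

definition L2_inner :: "'a measure \<Rightarrow> ('a \<Rightarrow> complex) \<Rightarrow> ('a \<Rightarrow> complex) \<Rightarrow> complex" where
  "L2_inner M f g = (LINT x|M. f x * cnj (g x))"

definition L2_norm :: "'a measure \<Rightarrow> ('a \<Rightarrow> complex) \<Rightarrow> real" where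
  "L2_norm M f = sqrt (LINT x|M. (cmod (f x))\<^sup>2)"

text \<open>Unconditional convergence of a family to \<open>f\<close> in \<open>L\<^sub>2\<close>. Membership in \<^const>\<open>L2_space\<close> is part
  of the definition because the integral of a non-integrable function is 0, so that \<^const>\<open>L2_norm\<close>
  is meaningless outside that space.\<close>

definition L2_has_sum :: "'a measure \<Rightarrow> ('i \<Rightarrow> 'a \<Rightarrow> complex) \<Rightarrow> 'i set \<Rightarrow> ('a \<Rightarrow> complex) \<Rightarrow> bool" where
  "L2_has_sum M F I f \<longleftrightarrow>
     f \<in> L2_space M \<and> (\<forall>i\<in>I. F i \<in> L2_space M) \<and>
     ((\<lambda>A. L2_norm M (\<lambda>x. f x - (\<Sum>i\<in>A. F i x))) \<longlongrightarrow> 0) (finite_subsets_at_top I)"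

definition parseval_tight_frame :: "'a measure \<Rightarrow> 'i set \<Rightarrow> ('i \<Rightarrow> 'a \<Rightarrow> complex) \<Rightarrow> bool" where
  "parseval_tight_frame M I \<psi> \<longleftrightarrow>
     (\<forall>i\<in>I. \<psi> i \<in> L2_space M) \<and>
     (\<forall>f\<in>L2_space M.
        L2_has_sum M (\<lambda>i x. L2_inner M f (\<psi> i) * \<psi> i x) I f \<and>
        ((\<lambda>i. (cmod (L2_inner M f (\<psi> i)))\<^sup>2) has_sum (L2_norm M f)\<^sup>2) I)"


section \<open>The frame functions\<close>

definition psi ::
    "(int \<Rightarrow> nat) \<Rightarrow> (int \<Rightarrow> nat \<Rightarrow> complex) \<Rightarrow> (int \<Rightarrow> 'k \<Rightarrow> real ^ 3) \<Rightarrow> (int \<Rightarrow> 'k \<Rightarrow> real) \<Rightarrow>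
     int \<Rightarrow> 'k \<Rightarrow> real ^ 3 \<Rightarrow> complex" where
  "psi L \<kappa> loc w j k \<omega> =
     (\<Sum>l\<le>L j. \<Sum>m\<in>{- int l..int l}.
        of_real (sqrt (4 * pi / (2 * real l + 1))) * of_real (sqrt (w j k)) * \<kappa> j l *
        sph_harm l m (loc j k) * sph_harm l m \<omega>)"

end

theory Submission
  imports Defs
begin

text \<open>
  The frame condition at scale \<open>j\<close> says that the weighted samples of the spherical harmonics up to
  degree \<open>L j\<close> are orthonormal. Expanding \<open>\<psi>_jk\<close> in spherical harmonics therefore gives
  \<open>\<Sum>_k \<bar><f, \<psi>_jk>\<bar>^2 = \<Sum>_lm (4 \<pi> / (2 l + 1)) \<bar>\<kappa>_l^j\<bar>^2 \<bar>f_lm\<bar>^2\<close>, and summing over \<open>j\<close> with the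
  Calderon condition leaves \<open>\<Sum>_lm \<bar>f_lm\<bar>^2 = \<parallel>f\<parallel>^2\<close>. The Parseval identity in turn implies the
  reconstruction formula, because the partial sums \<open>S_A f\<close> satisfy
  \<open>\<parallel>f - S_A f\<parallel>^2 \<le> \<parallel>f\<parallel>^2 - \<Sum>_{i \<in> A} \<bar><f, \<psi>_i>\<bar>^2\<close>.

  Orthonormality of the spherical harmonics reduces to Legendre's equation by partial integration.
  They are complete because they span exactly the restrictions of polynomials to the sphere, which
  are dense by the Stone--Weierstrass theorem.
\<close>

section \<open>Parseval families of square integrable functions\<close>

text \<open>Three obstacles shape the development. The harmonics are defined through angles, and the
  azimuth jumps, so they are rewritten on the sphere as a power of \<open>x + i y\<close> or of its
  conjugate times a polynomial in \<open>z\<close>; continuity, orthogonality and the span argument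
  all use this form. The frame condition is pointwise convergence over a possibly infinite unordered
  index set, so orthonormality of the samples has to be extracted as a limit statement about
  finitely many coefficients. The double series is claimed both unordered over all pairs
  \<open>(j, k)\<close> and scale by scale; in the second reading the value of each inner sum must
  be exhibited. It is \<open>f\<close> with its coefficients multiplied by \<open>|a j p|^2\<close>,
  a finite sum of harmonics because the window is bandlimited.\<close>

lemma L2_space_iff:
  "f \<in> L2_space M \<longleftrightarrow> f \<in> borel_measurable M \<and> integrable M (\<lambda>x. (cmod (f x))\<^sup>2)"
  by (simp add: L2_space_def)

lemma L2_space_measurable [measurable_dest]: "f \<in> L2_space M \<Longrightarrow> f \<in> borel_measurable M"
  by (simp add: L2_space_def)

lemma cmod_add_sq_le: "(cmod (a + b))\<^sup>2 \<le> 2 * (cmod a)\<^sup>2 + 2 * (cmod b)\<^sup>2"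
proof -
  have "(cmod (a + b))\<^sup>2 \<le> (cmod a + cmod b)\<^sup>2"
    by (intro power_mono norm_triangle_ineq) auto
  also have "\<dots> \<le> 2 * (cmod a)\<^sup>2 + 2 * (cmod b)\<^sup>2"
    using sum_squares_bound[of "cmod a" "cmod b"] by (simp add: power2_sum)
  finally show ?thesis .
qed

lemma Re_cnj_mult_self: "Re (cnj z * z) = (cmod z)\<^sup>2"
  by (simp add: cmod_power2 power2_eq_square[of "Re z"] power2_eq_square[of "Im z"])

lemma L2_space_add:
  assumes "f \<in> L2_space M" "g \<in> L2_space M"
  shows "(\<lambda>x. f x + g x) \<in> L2_space M"
proof -
  note [measurable] = assms[THEN L2_space_measurable]
  have "integrable M (\<lambda>x. (cmod (f x + g x))\<^sup>2)"
  proof (rule Bochner_Integration.integrable_bound)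
    show "integrable M (\<lambda>x. 2 * (cmod (f x))\<^sup>2 + 2 * (cmod (g x))\<^sup>2)"
      using assms by (simp add: L2_space_iff)
  qed (use cmod_add_sq_le in auto)
  then show ?thesis
    by (simp add: L2_space_iff)
qed

lemma L2_space_cmult:
  assumes "f \<in> L2_space M"
  shows "(\<lambda>x. c * f x) \<in> L2_space M"
  using assms borel_measurable_times[OF borel_measurable_const, of f M c]
  by (simp add: L2_space_iff norm_mult power_mult_distrib)

lemma L2_space_diff:
  assumes "f \<in> L2_space M" "g \<in> L2_space M"
  shows "(\<lambda>x. f x - g x) \<in> L2_space M"
  using L2_space_add[OF assms(1) L2_space_cmult[OF assms(2), of "-1"]] by simp

lemma L2_space_zero: "(\<lambda>x. 0) \<in> L2_space M"
  by (simp add: L2_space_iff)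

lemma L2_space_sum:
  assumes "\<And>i. i \<in> A \<Longrightarrow> F i \<in> L2_space M"
  shows "(\<lambda>x. \<Sum>i\<in>A. F i x) \<in> L2_space M"
  using assms
  by (induction A rule: infinite_finite_induct) (auto intro: L2_space_add L2_space_zero)

lemma L2_space_cong:
  assumes "f \<in> L2_space M" "\<And>x. x \<in> space M \<Longrightarrow> f x = g x"
  shows "g \<in> L2_space M"
proof -
  have "f \<in> borel_measurable M \<longleftrightarrow> g \<in> borel_measurable M"
    using assms(2) by (rule measurable_cong)
  moreover have "integrable M (\<lambda>x. (cmod (f x))\<^sup>2) \<longleftrightarrow> integrable M (\<lambda>x. (cmod (g x))\<^sup>2)"
    using assms(2) by (intro Bochner_Integration.integrable_cong) auto
  ultimately show ?thesis
    using assms(1) by (simp add: L2_space_iff)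
qed

lemma L2_integrable_mult:
  assumes "f \<in> L2_space M" "g \<in> L2_space M"
  shows "integrable M (\<lambda>x. f x * cnj (g x))"
proof -
  note [measurable] = assms[THEN L2_space_measurable]
  show ?thesis
  proof (rule Bochner_Integration.integrable_bound)
    show "integrable M (\<lambda>x. (cmod (f x))\<^sup>2 + (cmod (g x))\<^sup>2)"
      using assms by (simp add: L2_space_iff)
    have "norm (f x * cnj (g x)) \<le> (cmod (f x))\<^sup>2 + (cmod (g x))\<^sup>2" for x
    proof -
      have "0 \<le> cmod (f x) * cmod (g x)" by simp
      then show ?thesis
        unfolding norm_mult complex_mod_cnj
        using sum_squares_bound[of "cmod (f x)" "cmod (g x)"] by linarith
    qed
    then show "AE x in M. norm (f x * cnj (g x)) \<le> norm ((cmod (f x))\<^sup>2 + (cmod (g x))\<^sup>2)"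
      by simp
    have "cnj \<in> borel_measurable borel"
      by (intro borel_measurable_continuous_onI continuous_intros)
    then show "(\<lambda>x. f x * cnj (g x)) \<in> borel_measurable M"
      by measurable
  qed
qed

section \<open>The sesquilinear form and its seminorm\<close>

lemma L2_inner_cnj: "L2_inner M g f = cnj (L2_inner M f g)"
  unfolding L2_inner_def by (subst Bochner_Integration.integral_cnj[symmetric]) (simp add: mult.commute)

lemma L2_inner_add_left:
  assumes "f \<in> L2_space M" "g \<in> L2_space M" "h \<in> L2_space M"
  shows "L2_inner M (\<lambda>x. f x + g x) h = L2_inner M f h + L2_inner M g h"
  unfolding L2_inner_def
  by (simp add: distrib_right L2_integrable_mult assms Bochner_Integration.integral_add)

lemma L2_inner_cmult_left: "L2_inner M (\<lambda>x. c * f x) h = c * L2_inner M f h"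
  unfolding L2_inner_def by (simp add: mult.assoc)

lemma L2_inner_cmult_right: "L2_inner M f (\<lambda>x. c * h x) = cnj c * L2_inner M f h"
  unfolding L2_inner_cnj[of M f "\<lambda>x. c * h x"] L2_inner_cnj[of M f h] L2_inner_cmult_left
  by (rule complex_cnj_mult)

lemma L2_inner_sum_left:
  assumes "\<And>i. i \<in> A \<Longrightarrow> F i \<in> L2_space M" "h \<in> L2_space M"
  shows "L2_inner M (\<lambda>x. \<Sum>i\<in>A. F i x) h = (\<Sum>i\<in>A. L2_inner M (F i) h)"
  using assms
proof (induction A rule: infinite_finite_induct)
  case (insert i A)
  then show ?case
    by (simp add: L2_inner_add_left L2_space_sum)
qed (auto simp: L2_inner_def)

lemma L2_inner_sum_right:
  assumes "\<And>i. i \<in> A \<Longrightarrow> F i \<in> L2_space M" "h \<in> L2_space M"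
  shows "L2_inner M h (\<lambda>x. \<Sum>i\<in>A. F i x) = (\<Sum>i\<in>A. L2_inner M h (F i))"
  by (subst L2_inner_cnj) (simp add: L2_inner_sum_left assms L2_inner_cnj[of M h])

lemma L2_inner_cong:
  assumes "\<And>x. x \<in> space M \<Longrightarrow> f x = f' x" "\<And>x. x \<in> space M \<Longrightarrow> g x = g' x"
  shows "L2_inner M f g = L2_inner M f' g'"
  unfolding L2_inner_def using assms by (intro Bochner_Integration.integral_cong) auto

lemma L2_norm_sq_eq_integral: "(L2_norm M f)\<^sup>2 = (LINT x|M. (cmod (f x))\<^sup>2)"
  unfolding L2_norm_def by (intro real_sqrt_pow2 integral_nonneg_AE) auto

lemma L2_norm_nonneg: "0 \<le> L2_norm M f"
  unfolding L2_norm_def by (auto intro: integral_nonneg_AE)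

lemma L2_norm_cong:
  assumes "\<And>x. x \<in> space M \<Longrightarrow> f x = g x"
  shows "L2_norm M f = L2_norm M g"
  unfolding L2_norm_def using assms
  by (intro arg_cong[where f = sqrt] Bochner_Integration.integral_cong) auto

lemma L2_inner_self:
  "L2_inner M f f = of_real ((L2_norm M f)\<^sup>2)"
  unfolding L2_norm_sq_eq_integral L2_inner_def
  by (simp add: complex_norm_square[symmetric] flip: integral_complex_of_real)

lemma L2_norm_sq_eq: "(L2_norm M f)\<^sup>2 = Re (L2_inner M f f)"
  by (simp add: L2_inner_self)

lemma L2_norm_diff_sq:
  assumes "f \<in> L2_space M" "g \<in> L2_space M"
  shows "(L2_norm M (\<lambda>x. f x - g x))\<^sup>2 =
    (L2_norm M f)\<^sup>2 - 2 * Re (L2_inner M f g) + (L2_norm M g)\<^sup>2"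
proof -
  let ?d = "\<lambda>x. f x + (-1) * g x"
  note g' = L2_space_cmult[OF assms(2), of "-1"]
  have d: "?d \<in> L2_space M"
    by (rule L2_space_add[OF assms(1) g'])
  have expand: "L2_inner M ?d h = L2_inner M f h - L2_inner M g h" if "h \<in> L2_space M" for h
    using L2_inner_add_left[OF assms(1) g' that] L2_inner_cmult_left[of M "-1" g h] by simp
  have "L2_inner M ?d ?d = L2_inner M f ?d - L2_inner M g ?d"
    by (rule expand[OF d])
  also have "L2_inner M f ?d = cnj (L2_inner M f f - L2_inner M g f)"
    unfolding L2_inner_cnj[of M f ?d] expand[OF assms(1)] ..
  also have "L2_inner M g ?d = cnj (L2_inner M f g - L2_inner M g g)"
    unfolding L2_inner_cnj[of M g ?d] expand[OF assms(2)] ..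
  also have "L2_inner M g f = cnj (L2_inner M f g)"
    by (rule L2_inner_cnj)
  finally show ?thesis
    unfolding L2_norm_sq_eq by simp
qed

text \<open>The factor 2 stands in for the triangle inequality at the level of squared norms, in
  which the density arguments are phrased: two errors below \<open>e / 4\<close> give one below
  \<open>e\<close>.\<close>

lemma L2_norm_add_sq_le:
  assumes "f \<in> L2_space M" "g \<in> L2_space M"
  shows "(L2_norm M (\<lambda>x. f x + g x))\<^sup>2 \<le> 2 * (L2_norm M f)\<^sup>2 + 2 * (L2_norm M g)\<^sup>2"
proof -
  have "(LINT x|M. (cmod (f x + g x))\<^sup>2) \<le> (LINT x|M. 2 * (cmod (f x))\<^sup>2 + 2 * (cmod (g x))\<^sup>2)"
    using assms L2_space_add[OF assms] cmod_add_sq_le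
    by (intro integral_mono) (auto simp: L2_space_iff)
  also have "\<dots> = 2 * (LINT x|M. (cmod (f x))\<^sup>2) + 2 * (LINT x|M. (cmod (g x))\<^sup>2)"
    using assms by (simp add: L2_space_iff)
  finally show ?thesis
    unfolding L2_norm_sq_eq_integral .
qed

lemma L2_norm_cmult_sq: "(L2_norm M (\<lambda>x. c * f x))\<^sup>2 = (cmod c)\<^sup>2 * (L2_norm M f)\<^sup>2"
  unfolding L2_norm_sq_eq_integral by (simp add: norm_mult power_mult_distrib)

text \<open>Synthesis is adjoint to analysis: for \<open>g = \<Sum> c i \<psi> i\<close> one has
  \<open><g, g> = \<Sum> c i cnj <g, \<psi> i>\<close>. By
  \<open>2 |a| |b| \<le> |a|^2 + |b|^2\<close> and Bessel's inequality,
  \<open>2 ||g||^2 \<le> \<Sum> |c i|^2 + ||g||^2\<close>, and one \<open>||g||^2\<close>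
  cancels.\<close>

lemma bessel_synthesis_bound:
  assumes \<psi>: "\<And>i. i \<in> A \<Longrightarrow> \<psi> i \<in> L2_space M"
    and bessel: "\<And>g. g \<in> L2_space M \<Longrightarrow>
      (\<Sum>i\<in>A. (cmod (L2_inner M g (\<psi> i)))\<^sup>2) \<le> (L2_norm M g)\<^sup>2"
  shows "(L2_norm M (\<lambda>x. \<Sum>i\<in>A. c i * \<psi> i x))\<^sup>2 \<le> (\<Sum>i\<in>A. (cmod (c i))\<^sup>2)"
proof -
  define g where "g = (\<lambda>x. \<Sum>i\<in>A. c i * \<psi> i x)"
  have g: "g \<in> L2_space M"
    unfolding g_def by (intro L2_space_sum L2_space_cmult \<psi>)
  have "L2_inner M g g = (\<Sum>i\<in>A. c i * cnj (L2_inner M g (\<psi> i)))"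
    by (subst (1) g_def, subst L2_inner_sum_left)
       (auto intro: L2_space_cmult \<psi> g simp: L2_inner_cmult_left simp flip: L2_inner_cnj)
  then have "2 * (L2_norm M g)\<^sup>2 = (\<Sum>i\<in>A. 2 * Re (c i * cnj (L2_inner M g (\<psi> i))))"
    by (simp add: L2_norm_sq_eq sum_distrib_left)
  also have "\<dots> \<le> (\<Sum>i\<in>A. (cmod (c i))\<^sup>2 + (cmod (L2_inner M g (\<psi> i)))\<^sup>2)"
  proof (rule sum_mono)
    fix i
    have "Re (c i * cnj (L2_inner M g (\<psi> i))) \<le> cmod (c i) * cmod (L2_inner M g (\<psi> i))"
      using complex_Re_le_cmod[of "c i * cnj (L2_inner M g (\<psi> i))"] by (simp add: norm_mult)
    then show "2 * Re (c i * cnj (L2_inner M g (\<psi> i)))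
        \<le> (cmod (c i))\<^sup>2 + (cmod (L2_inner M g (\<psi> i)))\<^sup>2"
      using sum_squares_bound[of "cmod (c i)" "cmod (L2_inner M g (\<psi> i))"] by linarith
  qed
  also have "\<dots> \<le> (\<Sum>i\<in>A. (cmod (c i))\<^sup>2) + (L2_norm M g)\<^sup>2"
    using bessel[OF g] by (simp add: sum.distrib)
  finally show ?thesis
    by (simp add: g_def)
qed

lemma parseval_tight_frameI:
  assumes \<psi>: "\<And>i. i \<in> I \<Longrightarrow> \<psi> i \<in> L2_space M"
    and parseval: "\<And>f. f \<in> L2_space M \<Longrightarrow>
      ((\<lambda>i. (cmod (L2_inner M f (\<psi> i)))\<^sup>2) has_sum (L2_norm M f)\<^sup>2) I"
  shows "parseval_tight_frame M I \<psi>"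
proof -
  have "L2_has_sum M (\<lambda>i x. L2_inner M f (\<psi> i) * \<psi> i x) I f" if f: "f \<in> L2_space M" for f
  proof -
    let ?c = "\<lambda>i. L2_inner M f (\<psi> i)"
    let ?S = "\<lambda>A x. \<Sum>i\<in>A. ?c i * \<psi> i x"
    have bound: "(L2_norm M (\<lambda>x. f x - ?S A x))\<^sup>2 \<le> (L2_norm M f)\<^sup>2 - (\<Sum>i\<in>A. (cmod (?c i))\<^sup>2)"
      if A: "finite A" "A \<subseteq> I" for A
    proof -
      have \<psi>A: "\<psi> i \<in> L2_space M" if "i \<in> A" for i
        using \<psi> A that by auto
      have S: "?S A \<in> L2_space M"
        by (intro L2_space_sum L2_space_cmult \<psi>A)
      have "L2_inner M f (?S A) = (\<Sum>i\<in>A. cnj (?c i) * ?c i)"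
        by (subst L2_inner_sum_right)
           (auto intro: L2_space_cmult \<psi>A f simp: L2_inner_cmult_right)
      then have "Re (L2_inner M f (?S A)) = (\<Sum>i\<in>A. (cmod (?c i))\<^sup>2)"
        by (simp add: Re_cnj_mult_self del: times_complex.sel)
      \<comment> \<open>Bessel's inequality on \<open>A\<close> is a partial sum of the Parseval
        series over \<open>I\<close>. In the expansion of the square the cross term then contributes
        -2 times, and the norm of \<open>?S A\<close> at most +1 times, the same sum.\<close>
      moreover have "(L2_norm M (?S A))\<^sup>2 \<le> (\<Sum>i\<in>A. (cmod (?c i))\<^sup>2)"
        by (rule bessel_synthesis_bound[OF \<psi>A])
           (use A parseval in \<open>auto intro!: has_sum_mono_neutral[OF has_sum_finite parseval]\<close>)
      ultimately show ?thesis
        using L2_norm_diff_sq[OF f S] by linarith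
    qed
    have "((\<lambda>A. (L2_norm M f)\<^sup>2 - (\<Sum>i\<in>A. (cmod (?c i))\<^sup>2)) \<longlongrightarrow> (L2_norm M f)\<^sup>2 - (L2_norm M f)\<^sup>2)
        (finite_subsets_at_top I)"
      using parseval[OF f] unfolding has_sum_def by (intro tendsto_intros)
    then have lim: "((\<lambda>A. (L2_norm M f)\<^sup>2 - (\<Sum>i\<in>A. (cmod (?c i))\<^sup>2)) \<longlongrightarrow> 0) (finite_subsets_at_top I)"
      by simp
    have "((\<lambda>A. (L2_norm M (\<lambda>x. f x - ?S A x))\<^sup>2) \<longlongrightarrow> 0) (finite_subsets_at_top I)"
      by (rule tendsto_sandwich[OF _ _ tendsto_const lim])
         (auto intro!: eventually_finite_subsets_at_top_weakI bound)
    then have "((\<lambda>A. L2_norm M (\<lambda>x. f x - ?S A x)) \<longlongrightarrow> 0) (finite_subsets_at_top I)"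
      using tendsto_real_sqrt[of "\<lambda>A. (L2_norm M (\<lambda>x. f x - ?S A x))\<^sup>2" 0] L2_norm_nonneg by simp
    then show ?thesis
      unfolding L2_has_sum_def using f \<psi> by (auto intro: L2_space_cmult)
  qed
  then show ?thesis
    unfolding parseval_tight_frame_def using \<psi> parseval by blast
qed

section \<open>Orthonormal systems and Parseval's identity\<close>

definition L2_orthonormal :: "'a measure \<Rightarrow> 'i set \<Rightarrow> ('i \<Rightarrow> 'a \<Rightarrow> complex) \<Rightarrow> bool" where
  "L2_orthonormal M I y \<longleftrightarrow> (\<forall>i\<in>I. y i \<in> L2_space M) \<and>
     (\<forall>i\<in>I. \<forall>j\<in>I. L2_inner M (y i) (y j) = of_bool (i = j))"

lemma L2_orthonormal_subset: "L2_orthonormal M I y \<Longrightarrow> J \<subseteq> I \<Longrightarrow> L2_orthonormal M J y"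
  by (auto simp: L2_orthonormal_def subset_iff)

lemma
  assumes y: "L2_orthonormal M P y" and P: "finite P"
  shows L2_orthonormal_sum_space: "(\<lambda>x. \<Sum>p\<in>P. c p * y p x) \<in> L2_space M"
    and L2_orthonormal_sum_inner: "q \<in> P \<Longrightarrow> L2_inner M (\<lambda>x. \<Sum>p\<in>P. c p * y p x) (y q) = c q"
    and L2_orthonormal_inner_sum: "f \<in> L2_space M \<Longrightarrow>
      L2_inner M f (\<lambda>x. \<Sum>p\<in>P. c p * y p x) = (\<Sum>p\<in>P. cnj (c p) * L2_inner M f (y p))"
    and L2_orthonormal_sum_norm:
      "(L2_norm M (\<lambda>x. \<Sum>p\<in>P. c p * y p x))\<^sup>2 = (\<Sum>p\<in>P. (cmod (c p))\<^sup>2)"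
proof -
  have yL2: "y p \<in> L2_space M" if "p \<in> P" for p
    using y that by (simp add: L2_orthonormal_def)
  show S: "(\<lambda>x. \<Sum>p\<in>P. c p * y p x) \<in> L2_space M"
    by (intro L2_space_sum L2_space_cmult yL2)
  show inner: "L2_inner M (\<lambda>x. \<Sum>p\<in>P. c p * y p x) (y q) = c q" if "q \<in> P" for q
  proof -
    have "L2_inner M (\<lambda>x. \<Sum>p\<in>P. c p * y p x) (y q) = (\<Sum>p\<in>P. c p * L2_inner M (y p) (y q))"
      using that by (subst L2_inner_sum_left) (auto intro: L2_space_cmult yL2 simp: L2_inner_cmult_left)
    also have "\<dots> = (\<Sum>p\<in>P. if p = q then c p else 0)"
      using y that by (intro sum.cong) (auto simp: L2_orthonormal_def)
    finally show ?thesis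
      using P that by simp
  qed
  show inner_right: "L2_inner M f (\<lambda>x. \<Sum>p\<in>P. c p * y p x) = (\<Sum>p\<in>P. cnj (c p) * L2_inner M f (y p))"
    if "f \<in> L2_space M" for f
    using that
    by (subst L2_inner_sum_right) (auto intro: L2_space_cmult yL2 simp: L2_inner_cmult_right)
  show "(L2_norm M (\<lambda>x. \<Sum>p\<in>P. c p * y p x))\<^sup>2 = (\<Sum>p\<in>P. (cmod (c p))\<^sup>2)"
    unfolding L2_norm_sq_eq inner_right[OF S]
    by (simp add: inner Re_cnj_mult_self del: times_complex.sel)
qed

lemma L2_orthonormal_diff_norm:
  assumes y: "L2_orthonormal M P y" and P: "finite P" and f: "f \<in> L2_space M"
  shows "(L2_norm M (\<lambda>x. f x - (\<Sum>p\<in>P. c p * y p x)))\<^sup>2 = (L2_norm M f)\<^sup>2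
    - 2 * (\<Sum>p\<in>P. Re (cnj (c p) * L2_inner M f (y p))) + (\<Sum>p\<in>P. (cmod (c p))\<^sup>2)"
  by (simp add: L2_norm_diff_sq[OF f L2_orthonormal_sum_space[OF y P]]
      L2_orthonormal_inner_sum[OF y P f] L2_orthonormal_sum_norm[OF y P])

text \<open>Completing the square: the two sides differ by \<open>\<Sum> |c p - <f, y p>|^2\<close>,
  so the Fourier coefficients are the optimal choice.\<close>

lemma L2_orthonormal_best_approx:
  assumes y: "L2_orthonormal M P y" and P: "finite P" and f: "f \<in> L2_space M"
  shows "(L2_norm M f)\<^sup>2 - (\<Sum>p\<in>P. (cmod (L2_inner M f (y p)))\<^sup>2)
    \<le> (L2_norm M (\<lambda>x. f x - (\<Sum>p\<in>P. c p * y p x)))\<^sup>2"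
proof -
  have "0 \<le> (\<Sum>p\<in>P. (cmod (c p - L2_inner M f (y p)))\<^sup>2)"
    by (intro sum_nonneg) auto
  also have "\<dots> = (\<Sum>p\<in>P. (cmod (c p))\<^sup>2 - 2 * Re (cnj (c p) * L2_inner M f (y p))
      + (cmod (L2_inner M f (y p)))\<^sup>2)"
    unfolding cmod_power2 by (intro sum.cong) (auto simp: power2_eq_square algebra_simps)
  finally show ?thesis
    unfolding L2_orthonormal_diff_norm[OF assms]
    by (simp add: sum.distrib sum_subtractf sum_distrib_left)
qed

text \<open>Approximants are confined to \<open>L2_space M\<close> because outside it the integral
  of the square defaults to 0 and closeness would be meaningless.\<close>

definition L2_closure :: "'a measure \<Rightarrow> ('a \<Rightarrow> complex) set \<Rightarrow> ('a \<Rightarrow> complex) set" where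
  "L2_closure M V = {f \<in> L2_space M. \<forall>e>0. \<exists>g\<in>V \<inter> L2_space M. (L2_norm M (\<lambda>x. f x - g x))\<^sup>2 < e}"

text \<open>Bessel bounds every partial sum by \<open>||f||^2\<close>. Density and best
  approximation lift some partial sum above any smaller value, and monotonicity keeps all larger
  index sets there.\<close>

lemma L2_parseval:
  assumes y: "L2_orthonormal M I y"
    and dense: "f \<in> L2_closure M {\<lambda>x. \<Sum>p\<in>P. c p * y p x | P c. finite P \<and> P \<subseteq> I}"
  shows "((\<lambda>p. (cmod (L2_inner M f (y p)))\<^sup>2) has_sum (L2_norm M f)\<^sup>2) I"
proof -
  have f: "f \<in> L2_space M"
    using dense by (simp add: L2_closure_def)
  let ?s = "\<lambda>P. \<Sum>p\<in>P. (cmod (L2_inner M f (y p)))\<^sup>2"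
  have le: "?s P \<le> (L2_norm M f)\<^sup>2" if "finite P" "P \<subseteq> I" for P
    using L2_orthonormal_diff_norm[OF L2_orthonormal_subset[OF y that(2)] that(1) f,
        of "\<lambda>p. L2_inner M f (y p)"]
      zero_le_power2[of "L2_norm M (\<lambda>x. f x - (\<Sum>p\<in>P. L2_inner M f (y p) * y p x))"]
    by (simp add: Re_cnj_mult_self del: times_complex.sel)
  have "(?s \<longlongrightarrow> (L2_norm M f)\<^sup>2) (finite_subsets_at_top I)"
  proof (rule order_tendstoI)
    fix a assume "a < (L2_norm M f)\<^sup>2"
    then have "\<exists>g\<in>{\<lambda>x. \<Sum>p\<in>P. c p * y p x | P c. finite P \<and> P \<subseteq> I} \<inter> L2_space M.
        (L2_norm M (\<lambda>x. f x - g x))\<^sup>2 < (L2_norm M f)\<^sup>2 - a"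
      using dense by (simp add: L2_closure_def)
    then obtain P c where P: "finite P" "P \<subseteq> I"
      and close: "(L2_norm M (\<lambda>x. f x - (\<Sum>p\<in>P. c p * y p x)))\<^sup>2 < (L2_norm M f)\<^sup>2 - a"
      by auto
    have "a < ?s P"
      using L2_orthonormal_best_approx[OF L2_orthonormal_subset[OF y P(2)] P(1) f, of c] close
      by linarith
    moreover have "?s P \<le> ?s Q" if "finite Q" "P \<subseteq> Q" for Q
      using that by (intro sum_mono2) auto
    ultimately show "\<forall>\<^sub>F Q in finite_subsets_at_top I. a < ?s Q"
      unfolding eventually_finite_subsets_at_top using P by (intro exI[of _ P]) force
  next
    fix a assume "(L2_norm M f)\<^sup>2 < a"
    then show "\<forall>\<^sub>F Q in finite_subsets_at_top I. ?s Q < a"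
      by (intro eventually_finite_subsets_at_top_weakI) (use le in force)
  qed
  then show ?thesis
    by (simp add: has_sum_def)
qed


section \<open>Density in \<open>L\<^sub>2\<close>\<close>

lemma L2_closureI:
  assumes "f \<in> L2_space M"
    and "\<And>e. 0 < e \<Longrightarrow> \<exists>h. h \<in> L2_closure M V \<and> (L2_norm M (\<lambda>x. f x - h x))\<^sup>2 < e"
  shows "f \<in> L2_closure M V"
  unfolding L2_closure_def
proof safe
  fix e :: real assume "0 < e"
  then obtain h where h: "h \<in> L2_closure M V" "(L2_norm M (\<lambda>x. f x - h x))\<^sup>2 < e / 4"
    using assms(2)[of "e / 4"] by auto
  then obtain g where g: "g \<in> V" "g \<in> L2_space M" "(L2_norm M (\<lambda>x. h x - g x))\<^sup>2 < e / 4"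
    using \<open>0 < e\<close> unfolding L2_closure_def by (auto dest!: spec[of _ "e / 4"])
  have hL2: "h \<in> L2_space M"
    using h by (simp add: L2_closure_def)
  have "(L2_norm M (\<lambda>x. (f x - h x) + (h x - g x)))\<^sup>2 \<le>
      2 * (L2_norm M (\<lambda>x. f x - h x))\<^sup>2 + 2 * (L2_norm M (\<lambda>x. h x - g x))\<^sup>2"
    by (intro L2_norm_add_sq_le L2_space_diff assms(1) hL2 g(2))
  then have "(L2_norm M (\<lambda>x. f x - g x))\<^sup>2 < e"
    using h(2) g(3) by simp
  then show "\<exists>g\<in>V \<inter> L2_space M. (L2_norm M (\<lambda>x. f x - g x))\<^sup>2 < e"
    using g by blast
qed (rule assms(1))

lemma L2_closure_cong:
  assumes "f \<in> L2_closure M V" "\<And>x. x \<in> space M \<Longrightarrow> f x = g x"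
  shows "g \<in> L2_closure M V"
proof -
  have "L2_norm M (\<lambda>x. f x - h x) = L2_norm M (\<lambda>x. g x - h x)" for h
    using assms(2) by (intro L2_norm_cong) simp
  moreover have "g \<in> L2_space M"
    using assms by (auto simp: L2_closure_def intro: L2_space_cong[of f])
  ultimately show ?thesis
    using assms(1) by (simp add: L2_closure_def)
qed

lemma L2_closure_cmult:
  assumes V: "\<And>g. g \<in> V \<Longrightarrow> (\<lambda>x. c * g x) \<in> V" and f: "f \<in> L2_closure M V"
  shows "(\<lambda>x. c * f x) \<in> L2_closure M V"
  unfolding L2_closure_def
proof safe
  show "(\<lambda>x. c * f x) \<in> L2_space M"
    using f by (simp add: L2_closure_def L2_space_cmult)
  fix e :: real assume "0 < e"
  \<comment> \<open>The summand 1 keeps the denominator positive when \<open>c = 0\<close>.\<close>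
  then have "0 < e / ((cmod c)\<^sup>2 + 1)"
    by (intro divide_pos_pos add_nonneg_pos) auto
  then obtain g where g: "g \<in> V" "g \<in> L2_space M" "(L2_norm M (\<lambda>x. f x - g x))\<^sup>2 < e / ((cmod c)\<^sup>2 + 1)"
    using f unfolding L2_closure_def by blast
  have "(L2_norm M (\<lambda>x. c * f x - c * g x))\<^sup>2 = (cmod c)\<^sup>2 * (L2_norm M (\<lambda>x. f x - g x))\<^sup>2"
    using L2_norm_cmult_sq[of M c "\<lambda>x. f x - g x"] by (simp add: right_diff_distrib)
  also have "\<dots> \<le> ((cmod c)\<^sup>2 + 1) * (L2_norm M (\<lambda>x. f x - g x))\<^sup>2"
    by (intro mult_right_mono) auto
  also have "\<dots> < ((cmod c)\<^sup>2 + 1) * (e / ((cmod c)\<^sup>2 + 1))"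
    using g(3) by (intro mult_strict_left_mono) (auto simp: add_nonneg_pos)
  also have "\<dots> = e"
    by (simp add: add_nonneg_eq_0_iff)
  finally show "\<exists>g\<in>V \<inter> L2_space M. (L2_norm M (\<lambda>x. c * f x - g x))\<^sup>2 < e"
    using g V by (intro bexI[of _ "\<lambda>x. c * g x"]) (auto intro: L2_space_cmult)
qed

lemma L2_closure_add:
  assumes V: "\<And>f g. f \<in> V \<Longrightarrow> g \<in> V \<Longrightarrow> (\<lambda>x. f x + g x) \<in> V"
    and f: "f \<in> L2_closure M V" and g: "g \<in> L2_closure M V"
  shows "(\<lambda>x. f x + g x) \<in> L2_closure M V"
  unfolding L2_closure_def
proof safe
  have fg: "f \<in> L2_space M" "g \<in> L2_space M"
    using f g by (auto simp: L2_closure_def)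
  then show "(\<lambda>x. f x + g x) \<in> L2_space M"
    by (rule L2_space_add)
  fix e :: real assume "0 < e"
  then have "0 < e / 4" by simp
  then obtain f' g' where f': "f' \<in> V" "f' \<in> L2_space M" "(L2_norm M (\<lambda>x. f x - f' x))\<^sup>2 < e / 4"
    and g': "g' \<in> V" "g' \<in> L2_space M" "(L2_norm M (\<lambda>x. g x - g' x))\<^sup>2 < e / 4"
    using f g unfolding L2_closure_def by blast
  have "(L2_norm M (\<lambda>x. (f x - f' x) + (g x - g' x)))\<^sup>2 \<le>
      2 * (L2_norm M (\<lambda>x. f x - f' x))\<^sup>2 + 2 * (L2_norm M (\<lambda>x. g x - g' x))\<^sup>2"
    by (intro L2_norm_add_sq_le L2_space_diff fg f' g')
  then have "(L2_norm M (\<lambda>x. f x + g x - (f' x + g' x)))\<^sup>2 < e"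
    using f'(3) g'(3) by (simp add: algebra_simps)
  then show "\<exists>h\<in>V \<inter> L2_space M. (L2_norm M (\<lambda>x. f x + g x - h x))\<^sup>2 < e"
    using f' g' V by (intro bexI[of _ "\<lambda>x. f' x + g' x"]) (auto intro: L2_space_add)
qed

text \<open>Since \<open>|f - F n| \<le> 2 G\<close>, the function \<open>4 G^2\<close> dominates
  the squared error, and dominated convergence turns pointwise into \<open>L2\<close> convergence.
  Every limit in the passage from continuous to arbitrary functions goes through this lemma.\<close>

lemma L2_closure_dominated_limit:
  assumes F: "\<And>n. F n \<in> L2_closure M V"
    and lim: "\<And>x. x \<in> space M \<Longrightarrow> (\<lambda>n. F n x) \<longlonglongrightarrow> f x"
    and bound: "\<And>n x. x \<in> space M \<Longrightarrow> cmod (F n x) \<le> G x"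
    and G: "integrable M (\<lambda>x. (G x)\<^sup>2)"
  shows "f \<in> L2_closure M V"
proof (rule L2_closureI)
  have FL2: "F n \<in> L2_space M" for n
    using F by (simp add: L2_closure_def)
  note [measurable] = FL2[THEN L2_space_measurable]
  have f_meas [measurable]: "f \<in> borel_measurable M"
    by (rule borel_measurable_LIMSEQ_metric[of F]) (use lim in auto)
  have f_bound: "cmod (f x) \<le> G x" if "x \<in> space M" for x
    using that bound by (intro LIMSEQ_le_const2[OF tendsto_norm[OF lim]]) auto
  have "integrable M (\<lambda>x. (cmod (f x))\<^sup>2)"
    by (rule Bochner_Integration.integrable_bound[OF G]) (auto intro!: power_mono f_bound)
  then show f: "f \<in> L2_space M"
    by (simp add: L2_space_iff)
  have diff_bound: "(cmod (f x - F n x))\<^sup>2 \<le> 4 * (G x)\<^sup>2" if "x \<in> space M" for n x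
  proof -
    have "cmod (f x - F n x) \<le> 2 * G x"
      using norm_triangle_ineq4[of "f x" "F n x"] f_bound[OF that] bound[OF that, of n] by linarith
    then have "(cmod (f x - F n x))\<^sup>2 \<le> (2 * G x)\<^sup>2"
      by (intro power_mono) auto
    then show ?thesis by simp
  qed
  have "(\<lambda>n. LINT x|M. (cmod (f x - F n x))\<^sup>2) \<longlonglongrightarrow> (LINT x|M. 0)"
  proof (rule integral_dominated_convergence)
    show "integrable M (\<lambda>x. 4 * (G x)\<^sup>2)"
      using G by simp
    show "AE x in M. (\<lambda>n. (cmod (f x - F n x))\<^sup>2) \<longlonglongrightarrow> 0"
    proof (rule AE_I2)
      fix x assume "x \<in> space M"
      then have "(\<lambda>n. (cmod (f x - F n x))\<^sup>2) \<longlonglongrightarrow> (cmod (f x - f x))\<^sup>2"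
        by (intro tendsto_intros lim)
      then show "(\<lambda>n. (cmod (f x - F n x))\<^sup>2) \<longlonglongrightarrow> 0" by simp
    qed
    show "AE x in M. norm ((cmod (f x - F n x))\<^sup>2) \<le> 4 * (G x)\<^sup>2" for n
      using diff_bound by auto
  qed auto
  then have "(\<lambda>n. (L2_norm M (\<lambda>x. f x - F n x))\<^sup>2) \<longlonglongrightarrow> 0"
    by (simp add: L2_norm_sq_eq_integral)
  then have "\<forall>\<^sub>F n in sequentially. (L2_norm M (\<lambda>x. f x - F n x))\<^sup>2 < e" if "0 < e" for e
    using that by (rule order_tendstoD(2))
  then have "\<exists>n. (L2_norm M (\<lambda>x. f x - F n x))\<^sup>2 < e" if "0 < e" for e
    using that by (meson eventually_happens trivial_limit_sequentially)
  then show "\<exists>h. h \<in> L2_closure M V \<and> (L2_norm M (\<lambda>x. f x - h x))\<^sup>2 < e" if "0 < e" for e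
    using that F by blast
qed

text \<open>Dynkin's argument with the closed sets as intersection-stable generator. Indicators of
  closed sets are limits of continuous functions; complements and disjoint unions need only
  linearity and dominated limits, and finiteness of the measure makes the constant 1 a dominating
  function.\<close>

lemma L2_closure_indicator:
  fixes M :: "'a::metric_space measure"
  assumes fin: "finite_measure M"
    and add: "\<And>f g. f \<in> V \<Longrightarrow> g \<in> V \<Longrightarrow> (\<lambda>x. f x + g x) \<in> V"
    and cmult: "\<And>c g. g \<in> V \<Longrightarrow> (\<lambda>x. c * g x) \<in> V"
    and cont: "\<And>h. continuous_on UNIV h \<Longrightarrow> h \<in> L2_closure M V"
    and B: "B \<in> sets borel"
  shows "indicator B \<in> L2_closure M V"
proof -
  interpret finite_measure M by (rule fin)
  let ?P = "\<lambda>B. (indicator B :: 'a \<Rightarrow> complex) \<in> L2_closure M V"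
  have empty: "?P {}"
    using cont[of "\<lambda>_. 0"] by (simp add: indicator_def[abs_def])
  have B': "B \<in> sigma_sets UNIV {C. closed C}"
    using B by (simp add: borel_eq_closed)
  show ?thesis
  proof (rule sigma_sets_induct_disjoint[OF _ _ B'])
    show "Int_stable {C :: 'a set. closed C}"
      by (auto simp: Int_stable_def)
    show "?P C" if "C \<in> {C. closed C}" for C
    proof (cases "C = {}")
      case False
      \<comment> \<open>Tent functions of shrinking width around \<open>C\<close>. The empty set is
        treated apart because \<open>infdist\<close> to it is 0 by convention, which would make
        every tent constantly 1.\<close>
      let ?F = "\<lambda>n x. complex_of_real (max 0 (1 - real n * infdist x C))"
      show ?thesis
      proof (rule L2_closure_dominated_limit[where F = ?F and G = "\<lambda>_. 1"])
        show "?F n \<in> L2_closure M V" for n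
          by (intro cont continuous_intros)
        show "(\<lambda>n. ?F n x) \<longlonglongrightarrow> indicator C x" for x
        proof (cases "x \<in> C")
          case True
          then show ?thesis by simp
        next
          case x: False
          then have pos: "0 < infdist x C"
            using that False by (intro infdist_pos_not_in_closed) auto
          obtain N where N: "1 / infdist x C < real N"
            using reals_Archimedean2 by blast
          have "?F n x = 0" if "N \<le> n" for n
          proof -
            have "1 < real N * infdist x C"
              using N pos by (simp add: divide_less_eq)
            also have "\<dots> \<le> real n * infdist x C"
              using that pos by (intro mult_right_mono) auto
            finally show ?thesis by simp
          qed
          then have "(\<lambda>n. ?F n x) \<longlonglongrightarrow> 0"
            by (intro tendsto_eventually) (auto simp: eventually_sequentially)
          then show ?thesis
            using x by simp
        qed
        show "cmod (?F n x) \<le> 1" for n x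
          by (simp add: infdist_nonneg)
      qed simp
    qed (use empty in simp)
    show "?P {}" by (rule empty)
    show "?P (UNIV - A)" if "?P A" for A
    proof -
      have "(\<lambda>x. 1 + (-1) * indicator A x) \<in> L2_closure M V"
        by (rule L2_closure_add[OF add cont L2_closure_cmult[OF cmult that]]) simp_all
      then show ?thesis
        by (rule L2_closure_cong) (simp add: indicator_def)
    qed
    show "?P (\<Union>i. A i)" if "disjoint_family A" and A: "\<And>i. ?P (A i)" for A :: "nat \<Rightarrow> 'a set"
    proof (rule L2_closure_dominated_limit[where F = "\<lambda>n. indicator (\<Union>i<n. A i)" and G = "\<lambda>_. 1"])
      show "?P (\<Union>i<n. A i)" for n
      proof (induction n)
        case (Suc n)
        have "(\<lambda>x. indicator (\<Union>i<n. A i) x + indicator (A n) x :: complex) \<in> L2_closure M V"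
          by (intro L2_closure_add add Suc A)
        then show ?case
        proof (rule L2_closure_cong)
          fix x
          have "x \<notin> (\<Union>i<n. A i) \<or> x \<notin> A n"
            using that(1) by (auto simp: disjoint_family_on_def) (metis disjoint_iff less_irrefl)
          then show "indicator (\<Union>i<n. A i) x + indicator (A n) x = (indicator (\<Union>i<Suc n. A i) x :: complex)"
            by (auto simp: indicator_def less_Suc_eq)
        qed
      qed (use empty in \<open>simp add: indicator_def[abs_def]\<close>)
      show "(\<lambda>n. indicator (\<Union>i<n. A i) x) \<longlonglongrightarrow> (indicator (\<Union>i. A i) x :: complex)" for x
        by (rule LIMSEQ_indicator_UN)
    qed (auto simp: indicator_def)
  qed auto
qed

text \<open>Simple functions with \<open>|F n| \<le> 2 |f|\<close> reduce the claim to indicators. A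
  measurable set of \<open>M\<close> is only the trace on \<open>S\<close> of a Borel set of the
  ambient space, but closure membership depends on values in \<open>space M\<close> alone, so the
  indicator of the ambient set can be used instead.\<close>

lemma L2_dense_if_continuous:
  fixes M :: "'a::metric_space measure"
  assumes fin: "finite_measure M"
    and sets_M: "sets M = sets (restrict_space borel S)"
    and add: "\<And>f g. f \<in> V \<Longrightarrow> g \<in> V \<Longrightarrow> (\<lambda>x. f x + g x) \<in> V"
    and cmult: "\<And>c g. g \<in> V \<Longrightarrow> (\<lambda>x. c * g x) \<in> V"
    and cont: "\<And>h. continuous_on UNIV h \<Longrightarrow> h \<in> L2_closure M V"
    and f: "f \<in> L2_space M"
  shows "f \<in> L2_closure M V"
proof -
  have space_M: "space M = S"
    using sets_eq_imp_space_eq[OF sets_M] by (simp add: space_restrict_space)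
  have "f \<in> borel_measurable M"
    using f by (simp add: L2_space_iff)
  from borel_measurable_implies_sequence_metric[OF this, of 0]
  obtain F where F: "\<And>i. simple_function M (F i)"
    "\<And>x. x \<in> space M \<Longrightarrow> (\<lambda>i. F i x) \<longlonglongrightarrow> f x"
    "\<And>i x. x \<in> space M \<Longrightarrow> dist (F i x) 0 \<le> 2 * dist (f x) 0"
    by blast
  show ?thesis
  proof (rule L2_closure_dominated_limit[where F = F and G = "\<lambda>x. 2 * cmod (f x)"])
    fix n
    let ?T = "\<lambda>y. F n -` {y} \<inter> space M"
    have level: "(\<lambda>x. y * indicator (?T y) x) \<in> L2_closure M V" for y
    proof -
      have "?T y \<in> sets M"
        using F(1) by (rule simple_functionD(2))
      then obtain B where B: "B \<in> sets borel" "?T y = S \<inter> B"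
        by (auto simp: sets_M sets_restrict_space)
      have "(\<lambda>x. y * indicator B x) \<in> L2_closure M V"
        by (intro L2_closure_cmult cmult L2_closure_indicator fin add cont B) auto
      then show ?thesis
        by (rule L2_closure_cong) (use B space_M in \<open>auto simp: indicator_def\<close>)
    qed
    have "(\<lambda>x. \<Sum>y\<in>Y. y * indicator (?T y) x) \<in> L2_closure M V" if "finite Y" for Y
      using that
    proof (induction Y rule: finite_induct)
      case empty
      then show ?case using cont[of "\<lambda>_. 0"] by simp
    next
      case (insert y Y)
      then show ?case
        unfolding sum.insert[OF insert.hyps] by (intro L2_closure_add[OF add level])
    qed
    then have "(\<lambda>x. \<Sum>y\<in>F n ` space M. y * indicator (?T y) x) \<in> L2_closure M V"
      using F(1) by (simp add: simple_functionD)
    then show "F n \<in> L2_closure M V"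
    proof (rule L2_closure_cong)
      fix x assume x: "x \<in> space M"
      have "(\<Sum>y\<in>F n ` space M. y * indicator (?T y) x) = (\<Sum>y\<in>F n ` space M. if y = F n x then F n x else 0)"
        using x by (intro sum.cong) (auto simp: indicator_def)
      then show "(\<Sum>y\<in>F n ` space M. y * indicator (?T y) x) = F n x"
        using x F(1)[of n] by (simp add: simple_functionD)
    qed
  next
    show "integrable M (\<lambda>x. (2 * cmod (f x))\<^sup>2)"
      using f by (simp add: L2_space_iff power_mult_distrib)
  qed (use F in auto)
qed


section \<open>Integrals of associated Legendre functions\<close>

text \<open>The substitution \<open>x = cos t\<close> makes this the integral of \<open>p\<close> over \<open>[-1, 1]\<close>.\<close>

definition cos_integral :: "real poly \<Rightarrow> real" where
  "cos_integral p = (LINT t|lborel. (poly p (cos t) * sin t) * indicator {0..pi} t)"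

lemma cos_integral_integrable:
  "integrable lborel (\<lambda>t. (poly p (cos t) * sin t) * indicator {0..pi} t)"
proof -
  have "integrable lborel (\<lambda>t. indicator {0..pi} t *\<^sub>R (poly p (cos t) * sin t))"
    by (intro borel_integrable_compact continuous_intros) auto
  then show ?thesis
    by (simp add: mult.commute)
qed

lemma cos_integral_add: "cos_integral (p + q) = cos_integral p + cos_integral q"
  unfolding cos_integral_def
  by (simp add: distrib_right cos_integral_integrable Bochner_Integration.integral_add)

lemma cos_integral_smult: "cos_integral (smult c p) = c * cos_integral p"
  unfolding cos_integral_def by (simp add: mult.assoc)

lemma cos_integral_pderiv: "cos_integral (pderiv q) = poly q 1 - poly q (-1)"
proof -
  have "cos_integral (pderiv q) = - poly q (cos pi) - (- poly q (cos 0))"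
    unfolding cos_integral_def
  proof (rule integral_FTC_Icc_real)
    show "((\<lambda>t. - poly q (cos t)) has_real_derivative poly (pderiv q) (cos t) * sin t) (at t)" for t
      by (auto intro!: derivative_eq_intros)
  qed (auto intro!: continuous_intros)
  then show ?thesis by simp
qed

lemma cos_integral_by_parts:
  assumes "poly p 1 = 0" "poly p (-1) = 0"
  shows "cos_integral (p * pderiv q) = - cos_integral (pderiv p * q)"
  using cos_integral_pderiv[of "p * q"] assms
  by (simp add: pderiv_mult cos_integral_add mult.commute[of q])

text \<open>This is the Beta integral \<open>B(1/2, l + 1)\<close>. The recursion comes from
  integrating the derivative of \<open>x (1 - x^2)^(l + 1)\<close>, which vanishes at both ends,
  after writing \<open>x^2 = 1 - (1 - x^2)\<close>.\<close>

lemma cos_integral_one_minus_sq_power: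
  "cos_integral ([:1, 0, -1:] ^ l) = 2 ^ (2 * l + 1) * (fact l)\<^sup>2 / fact (2 * l + 1)"
proof (induction l)
  case 0
  show ?case
    using cos_integral_pderiv[of "[:0, 1:]"] by (simp add: pderiv_pCons one_pCons)
next
  case (Suc l)
  have "pderiv ([:0, 1:] * [:1, 0, -1:] ^ Suc l)
      = smult (2 * real l + 3) ([:1, 0, -1:] ^ Suc l) + smult (- (2 * real l + 2)) ([:1, 0, -1:] ^ l)"
    (is "?d = ?r")
  proof -
    have "poly ?d x = poly ?r x" for x
      unfolding pderiv_mult pderiv_power_Suc
      by (simp add: pderiv_pCons algebra_simps)
    then show ?thesis by (simp add: poly_eq_poly_eq_iff[symmetric] fun_eq_iff)
  qed
  then have "cos_integral (smult (2 * real l + 3) ([:1, 0, -1:] ^ Suc l) + smult (- (2 * real l + 2)) ([:1, 0, -1:] ^ l)) = 0"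
    using cos_integral_pderiv[of "[:0, 1:] * [:1, 0, -1:] ^ Suc l"] by simp
  then have "(2 * real l + 3) * cos_integral ([:1, 0, -1:] ^ Suc l)
      = (2 * real l + 2) * cos_integral ([:1, 0, -1:] ^ l)"
    unfolding cos_integral_add cos_integral_smult by linarith
  then have "cos_integral ([:1, 0, -1:] ^ Suc l)
      = (2 * real l + 2) / (2 * real l + 3) * cos_integral ([:1, 0, -1:] ^ l)"
    by (simp add: field_simps)
  also have "\<dots> = 2 ^ (2 * Suc l + 1) * (fact (Suc l))\<^sup>2 / fact (2 * Suc l + 1)"
  proof -
    define a b :: real where "a = real l + 1" and "b = 2 * real l + 3"
    have "a \<noteq> 0" "b \<noteq> 0"
      by (auto simp: a_def b_def)
    moreover have "fact (2 * Suc l + 1) = b * (2 * a) * (fact (2 * l + 1) :: real)"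
      by (simp add: a_def b_def algebra_simps)
    moreover have "(fact (Suc l))\<^sup>2 = a\<^sup>2 * (fact l :: real)\<^sup>2" "2 * real l + 2 = 2 * a" "2 * real l + 3 = b"
      "(2 :: real) ^ (2 * Suc l + 1) = 4 * 2 ^ (2 * l + 1)"
      by (simp_all add: a_def b_def power_mult_distrib)
    ultimately show ?thesis
      unfolding Suc.IH by (simp add: divide_simps power2_eq_square)
  qed
  finally show ?case .
qed

text \<open>The equation \<open>(x^2 - 1) w' = 2 l x w\<close> for \<open>w = (x^2 - 1)^l\<close>, differentiated \<open>k + 1\<close> times.\<close>

lemma rodrigues_ode:
  fixes l :: nat
  defines "w \<equiv> [:-1, 0, 1 :: real:] ^ l"
  shows "[:-1, 0, 1:] * (pderiv ^^ (k + 2)) w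
      + smult (2 * (real k + 1) - 2 * real l) ([:0, 1:] * (pderiv ^^ (k + 1)) w)
      + smult ((real k + 1) * (real k - 2 * real l)) ((pderiv ^^ k) w) = 0"
proof (induction k)
  case 0
  have first_order: "[:-1, 0, 1:] * pderiv w - smult (2 * real l) ([:0, 1:] * w) = 0"
  proof (cases l)
    case (Suc l')
    have "poly ([:-1, 0, 1:] * pderiv w - smult (2 * real l) ([:0, 1:] * w)) x = 0" for x
      unfolding w_def Suc pderiv_power_Suc by (simp add: pderiv_pCons algebra_simps)
    then show ?thesis
      by (simp add: poly_all_0_iff_0[symmetric])
  qed (simp add: w_def)
  have "[:-1, 0, 1:] * (pderiv ^^ (0 + 2)) w
      + smult (2 * (real 0 + 1) - 2 * real l) ([:0, 1:] * (pderiv ^^ (0 + 1)) w)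
      + smult ((real 0 + 1) * (real 0 - 2 * real l)) ((pderiv ^^ 0) w)
      = pderiv ([:-1, 0, 1:] * pderiv w - smult (2 * real l) ([:0, 1:] * w))" (is "?a = ?b")
  proof -
    have "poly ?a x = poly ?b x" for x
      by (simp add: numeral_2_eq_2 pderiv_mult pderiv_add pderiv_diff pderiv_smult pderiv_pCons algebra_simps)
    then show ?thesis by (simp add: poly_eq_poly_eq_iff[symmetric] fun_eq_iff)
  qed
  then show ?case
    unfolding first_order by simp
next
  case (Suc k)
  define u where "u = (pderiv ^^ k) w"
  have pow: "(pderiv ^^ k) w = u" "(pderiv ^^ (k + 1)) w = pderiv u"
    "(pderiv ^^ (k + 2)) w = pderiv (pderiv u)" "(pderiv ^^ (Suc k + 1)) w = pderiv (pderiv u)"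
    "(pderiv ^^ (Suc k + 2)) w = pderiv (pderiv (pderiv u))" "(pderiv ^^ (Suc k)) w = pderiv u"
    by (simp_all add: u_def)
  have "[:-1, 0, 1:] * pderiv (pderiv (pderiv u))
      + smult (2 * (real (Suc k) + 1) - 2 * real l) ([:0, 1:] * pderiv (pderiv u))
      + smult ((real (Suc k) + 1) * (real (Suc k) - 2 * real l)) (pderiv u)
    = pderiv ([:-1, 0, 1:] * pderiv (pderiv u)
      + smult (2 * (real k + 1) - 2 * real l) ([:0, 1:] * pderiv u)
      + smult ((real k + 1) * (real k - 2 * real l)) u)" (is "?a = ?b")
  proof -
    have "poly ?a x = poly ?b x" for x
      unfolding pderiv_add pderiv_smult pderiv_mult
      by (simp add: pderiv_pCons algebra_simps)
    then show ?thesis by (simp add: poly_eq_poly_eq_iff[symmetric] fun_eq_iff)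
  qed
  then show ?case
    using Suc.IH unfolding pow by simp
qed

section \<open>Legendre's equation and the norms of associated Legendre functions\<close>

lemma higher_pderiv_legendre_poly:
  "(pderiv ^^ n) (legendre_poly l) = smult (1 / (2 ^ l * fact l)) ((pderiv ^^ (n + l)) ([:-1, 0, 1:] ^ l))"
  unfolding legendre_poly_def by (simp add: higher_pderiv_smult funpow_add)

text \<open>The self-adjoint form of \<open>rodrigues_ode\<close> at \<open>k = n + l\<close>:
  multiplying by \<open>(1 - x^2)^n\<close> makes the first two terms an exact derivative. For
  \<open>n = 0\<close> this is Legendre's equation with eigenvalue \<open>l (l + 1)\<close>.\<close>

lemma legendre_ode:
  "pderiv ([:1, 0, -1:] ^ Suc n * (pderiv ^^ Suc n) (legendre_poly l))
    = smult (- ((real l + real n + 1) * (real l - real n)))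
        ([:1, 0, -1:] ^ n * (pderiv ^^ n) (legendre_poly l))" (is "?d = ?r")
proof -
  define v where "v = (pderiv ^^ (n + l)) ([:-1, 0, 1 :: real:] ^ l)"
  define c :: real where "c = 1 / (2 ^ l * fact l)"
  have Q: "(pderiv ^^ n) (legendre_poly l) = smult c v"
    by (simp add: higher_pderiv_legendre_poly v_def c_def)
  have "[:-1, 0, 1:] * pderiv (pderiv v)
      + smult (2 * (real (n + l) + 1) - 2 * real l) ([:0, 1:] * pderiv v)
      + smult ((real (n + l) + 1) * (real (n + l) - 2 * real l)) v = 0"
    using rodrigues_ode[of "n + l" l] by (simp add: v_def)
  then have "poly ([:-1, 0, 1:] * pderiv (pderiv v)
      + smult (2 * (real (n + l) + 1) - 2 * real l) ([:0, 1:] * pderiv v)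
      + smult ((real (n + l) + 1) * (real (n + l) - 2 * real l)) v) x = 0" for x
    by (metis poly_0)
  then have ode: "(1 - x * x) * poly (pderiv (pderiv v)) x = 2 * (real n + 1) * x * poly (pderiv v) x
      - (real l + real n + 1) * (real l - real n) * poly v x" for x
    by (simp add: algebra_simps)
  have "poly ?d x = poly ?r x" for x
  proof -
    have "poly ?d x = c * (1 - x * x) ^ n * ((1 - x * x) * poly (pderiv (pderiv v)) x
        - 2 * (real n + 1) * x * poly (pderiv v) x)"
      unfolding pderiv_mult pderiv_power_Suc funpow.simps o_apply Q pderiv_smult
      by (simp add: pderiv_pCons algebra_simps)
    also have "\<dots> = poly ?r x"
      unfolding ode Q by (simp add: algebra_simps)
    finally show ?thesis .
  qed
  then show ?thesis by (simp add: poly_eq_poly_eq_iff[symmetric] fun_eq_iff)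
qed

text \<open>The inner product on \<open>[-1, 1]\<close> of two associated Legendre functions of the
  same order \<open>n\<close>; their factors \<open>(1 - x^2)^(n/2)\<close> combine to a polynomial
  weight, and their signs cancel.\<close>

definition legendre_integral :: "nat \<Rightarrow> nat \<Rightarrow> nat \<Rightarrow> real" where
  "legendre_integral n l l' = cos_integral
     ([:1, 0, -1:] ^ n * (pderiv ^^ n) (legendre_poly l) * (pderiv ^^ n) (legendre_poly l'))"

lemma legendre_integral_commute: "legendre_integral n l l' = legendre_integral n l' l"
  by (simp add: legendre_integral_def ac_simps)

text \<open>Partial integration moves one derivative onto the self-adjoint expression, whose factor
  \<open>(1 - x^2)^(n + 1)\<close> kills the boundary terms. Every order is thus reduced to order 0,
  and the factor \<open>l - n\<close> makes the integral vanish once the order exceeds the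
  degree.\<close>

lemma legendre_integral_Suc:
  "legendre_integral (Suc n) l l' = (real l + real n + 1) * (real l - real n) * legendre_integral n l l'"
proof -
  let ?p = "[:1, 0, -1:] ^ Suc n * (pderiv ^^ Suc n) (legendre_poly l)"
  have "legendre_integral (Suc n) l l' = cos_integral (?p * pderiv ((pderiv ^^ n) (legendre_poly l')))"
    by (simp add: legendre_integral_def)
  also have "\<dots> = - cos_integral (pderiv ?p * (pderiv ^^ n) (legendre_poly l'))"
    by (intro cos_integral_by_parts) auto
  also have "\<dots> = (real l + real n + 1) * (real l - real n) * legendre_integral n l l'"
    unfolding legendre_ode mult_smult_left cos_integral_smult legendre_integral_def by simp
  finally show ?thesis .
qed

text \<open>Eigenfunctions for distinct eigenvalues: at order 0 the recursion may be applied to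
  either argument, and \<open>l (l + 1) - l' (l' + 1) = (l - l') (l + l' + 1)\<close> is
  nonzero.\<close>

lemma legendre_integral_eq_0:
  assumes "l \<noteq> l'"
  shows "legendre_integral n l l' = 0"
proof (induction n)
  case 0
  have "(real l + 1) * real l * legendre_integral 0 l l' = (real l' + 1) * real l' * legendre_integral 0 l l'"
    using legendre_integral_Suc[of 0 l l'] legendre_integral_Suc[of 0 l' l]
    by (simp add: legendre_integral_commute[of _ l'])
  then have "(real l - real l') * (real l + real l' + 1) * legendre_integral 0 l l' = 0"
    by (simp add: algebra_simps)
  moreover have "real l + real l' + 1 \<noteq> 0"
    by linarith
  ultimately show ?case
    using assms by simp
qed (simp add: legendre_integral_Suc)

lemma legendre_integral_fact:
  assumes "n \<le> l"
  shows "legendre_integral n l l = fact (l + n) / fact (l - n) * legendre_integral 0 l l"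
  using assms
proof (induction n)
  case (Suc n)
  define r where "r = real l - real n"
  have "r \<noteq> 0"
    using Suc.prems by (simp add: r_def)
  have "fact (l - n) = r * fact (l - Suc n)"
    using Suc.prems fact_Suc[of "l - Suc n", where ?'a = real] by (simp add: r_def Suc_diff_Suc of_nat_diff)
  then have "legendre_integral n l l = fact (l + n) / (r * fact (l - Suc n)) * legendre_integral 0 l l"
    using Suc by simp
  then have "r * legendre_integral n l l = fact (l + n) / fact (l - Suc n) * legendre_integral 0 l l"
    using \<open>r \<noteq> 0\<close> by simp
  then show ?case
    by (simp add: legendre_integral_Suc mult.assoc flip: r_def)
qed simp

lemma degree_x_sq_minus_1_power: "degree ([:-1, 0, 1 :: real:] ^ l) = 2 * l"
  by (simp add: degree_power_eq)

lemma degree_higher_pderiv_legendre_poly: "degree ((pderiv ^^ n) (legendre_poly l)) = l - n"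
  by (simp add: higher_pderiv_legendre_poly degree_higher_pderiv degree_x_sq_minus_1_power)

text \<open>Rodrigues' formula leaves the \<open>2 l\<close>-th derivative of a monic polynomial of
  degree \<open>2 l\<close>, hence the constant \<open>(2 l)!\<close>.\<close>

lemma higher_pderiv_legendre_poly_self:
  "(pderiv ^^ l) (legendre_poly l) = [:fact (2 * l) / (2 ^ l * fact l):]"
proof -
  have deg: "degree ((pderiv ^^ (l + l)) ([:-1, 0, 1 :: real:] ^ l)) = 0"
    by (simp add: degree_higher_pderiv degree_x_sq_minus_1_power)
  have x_sq: "coeff [:-1, 0, 1 :: real:] 2 = 1"
    by (simp add: numeral_2_eq_2)
  have "coeff ((pderiv ^^ (l + l)) ([:-1, 0, 1 :: real:] ^ l)) 0 = fact (2 * l)"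
    using lead_coeff_power[of "[:-1, 0, 1 :: real:]" l] x_sq
    by (simp add: coeff_higher_pderiv degree_x_sq_minus_1_power pochhammer_fact mult_2 flip: One_nat_def)
  then have "(pderiv ^^ (l + l)) ([:-1, 0, 1 :: real:] ^ l) = [:fact (2 * l):]"
    using degree_0_id[OF deg] by simp
  then show ?thesis
    by (simp add: higher_pderiv_legendre_poly)
qed

lemma higher_pderiv_legendre_poly_nonzero:
  assumes "n \<le> l"
  shows "(pderiv ^^ n) (legendre_poly l) \<noteq> 0"
proof
  assume "(pderiv ^^ n) (legendre_poly l) = 0"
  then have "(pderiv ^^ ((l - n) + n)) (legendre_poly l) = (pderiv ^^ (l - n)) 0"
    by (simp only: funpow_add o_apply)
  also have "(pderiv ^^ (l - n)) 0 = (0 :: real poly)"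
    by (induction "l - n") auto
  finally show False
    using assms by (simp add: higher_pderiv_legendre_poly_self)
qed

text \<open>The normalisation is computed at order \<open>n = l\<close>, where the derivatives are
  constants and only the Beta integral remains. Dividing by the factorials of
  \<open>legendre_integral_fact\<close> gives order 0, from which every other order follows.\<close>

lemma legendre_integral_eq:
  "legendre_integral n l l' = (if l = l' \<and> n \<le> l then 2 / (2 * real l + 1) * (fact (l + n) / fact (l - n)) else 0)"
proof (cases "l = l' \<and> n \<le> l")
  case True
  have "legendre_integral l l l = (fact (2 * l) / (2 ^ l * fact l))\<^sup>2 * cos_integral ([:1, 0, -1:] ^ l)"
    by (simp add: legendre_integral_def higher_pderiv_legendre_poly_self cos_integral_smult power2_eq_square)
  also have "\<dots> = fact (2 * l) * (2 / (2 * real l + 1))"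
  proof -
    have "fact (2 * l + 1) = (2 * real l + 1) * fact (2 * l)" "(2 :: real) ^ (2 * l + 1) = 2 * (2 ^ l)\<^sup>2"
      by (simp_all add: power_even_eq)
    moreover have "2 * real l + 1 \<noteq> 0"
      by linarith
    ultimately show ?thesis
      unfolding cos_integral_one_minus_sq_power by (simp add: divide_simps power2_eq_square)
  qed
  finally have "fact (2 * l) * legendre_integral 0 l l = fact (2 * l) * (2 / (2 * real l + 1))"
    using legendre_integral_fact[of l l] by (simp flip: mult_2)
  then have "legendre_integral 0 l l = 2 / (2 * real l + 1)"
    by (metis fact_nonzero mult_left_cancel)
  then show ?thesis
    using True legendre_integral_fact[of n l] by (simp add: ac_simps)
next
  case False
  then consider "l \<noteq> l'" | "l = l'" "l < n" by linarith
  then show ?thesis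
  proof cases
    case 2
    have "legendre_integral m l l = 0" if "l < m" for m
      using that
    proof (induction m)
      case (Suc m)
      then show ?case by (cases "m = l") (auto simp: legendre_integral_Suc)
    qed simp
    then show ?thesis using 2 by simp
  qed (simp add: legendre_integral_eq_0)
qed


section \<open>Orthonormality of the spherical harmonics\<close>

lemma S2_coordinates: "\<omega> \<in> S2 \<Longrightarrow> (\<omega> $ 1)\<^sup>2 + (\<omega> $ 2)\<^sup>2 + (\<omega> $ 3)\<^sup>2 = 1"
  by (simp add: norm_vec_def L2_set_def sum_3)

lemma spherical_point_nth [simp]:
  "spherical_point \<theta> \<phi> $ 1 = sin \<theta> * cos \<phi>"
  "spherical_point \<theta> \<phi> $ 2 = sin \<theta> * sin \<phi>"
  "spherical_point \<theta> \<phi> $ 3 = cos \<theta>"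
  by (simp_all add: spherical_point_def)

lemma norm_spherical_point [simp]: "norm (spherical_point \<theta> \<phi>) = 1"
proof -
  have "(sin \<theta> * cos \<phi>)\<^sup>2 + (sin \<theta> * sin \<phi>)\<^sup>2 + (cos \<theta>)\<^sup>2
      = (sin \<theta>)\<^sup>2 * ((sin \<phi>)\<^sup>2 + (cos \<phi>)\<^sup>2) + (cos \<theta>)\<^sup>2"
    by (simp only: power_mult_distrib distrib_left add.commute add.left_commute)
  then show ?thesis
    by (simp add: norm_vec_def L2_set_def sum_3)
qed

lemma continuous_spherical_point:
  "continuous_on A (\<lambda>p. spherical_point (fst p) (snd p))"
proof -
  have "continuous_on A (\<lambda>p. spherical_point (fst p) (snd p) $ i)" for i
    using exhaust_3[of i] by (elim disjE; simp; intro continuous_intros)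
  then have "continuous_on A (\<lambda>p. \<chi> i. spherical_point (fst p) (snd p) $ i)"
    by (rule continuous_on_vec_lambda)
  then show ?thesis by simp
qed

lemma space_sphere_measure [simp]: "space sphere_measure = S2"
  by (simp add: sphere_measure_def space_restrict_space)

lemma sets_sphere_measure [simp, measurable_cong]: "sets sphere_measure = sets (restrict_space borel S2)"
  by (simp add: sphere_measure_def)

text \<open>Pull-back along the coordinate map with density \<open>sin \<theta>\<close>, nonnegative
  on the box. Continuity on the compact box yields integrability; the coordinate version is what
  Fubini's theorem asks for in \<open>L2_inner_sph_generator\<close>.\<close>

lemma
  fixes F :: "real ^ 3 \<Rightarrow> 'b::{banach, second_countable_topology}"
  assumes F: "continuous_on S2 F"
  shows integrable_sphere_measure: "integrable sphere_measure F"
    and integral_sphere_measure: "(LINT \<omega>|sphere_measure. F \<omega>) =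
      (LINT p|lborel. (sin (fst p) * indicator ({0..pi} \<times> {0..2 * pi}) p) *\<^sub>R F (spherical_point (fst p) (snd p)))"
    and integrable_sphere_coordinates: "integrable lborel
      (\<lambda>p. (sin (fst p) * indicator ({0..pi} \<times> {0..2 * pi}) p) *\<^sub>R F (spherical_point (fst p) (snd p)))"
proof -
  let ?box = "{0..pi} \<times> {0..2 * pi}"
  let ?g = "\<lambda>p :: real \<times> real. sin (fst p) * indicator ?box p"
  let ?sp = "\<lambda>p. spherical_point (fst p) (snd p)"
  have sp_borel: "?sp \<in> borel_measurable borel"
    by (intro borel_measurable_continuous_onI continuous_spherical_point)
  then have sp: "?sp \<in> measurable (density lborel (\<lambda>p. ennreal (?g p))) (restrict_space borel S2)"
    by (intro measurable_restrict_space2) auto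
  have FM: "F \<in> borel_measurable (restrict_space borel S2)"
    using F by (rule borel_measurable_continuous_on_restrict)
  have Fsp: "continuous_on ?box (\<lambda>p. F (?sp p))"
    by (rule continuous_on_compose2[OF F continuous_spherical_point])
       auto
  have g_meas: "?g \<in> borel_measurable lborel"
  proof (rule borel_measurable_times)
    have "(\<lambda>p :: real \<times> real. sin (fst p)) \<in> borel_measurable borel"
      by (intro borel_measurable_continuous_onI continuous_intros)
    then show "(\<lambda>p :: real \<times> real. sin (fst p)) \<in> borel_measurable lborel"
      by simp
    show "indicator ?box \<in> borel_measurable lborel"
      by (intro borel_measurable_indicator) (auto intro: borel_closed closed_Times)
  qed
  have g_nonneg: "AE p in lborel. 0 \<le> ?g p"
    by (auto simp: indicator_def sin_ge_zero)
  have Fsp_meas: "(\<lambda>p. F (?sp p)) \<in> borel_measurable lborel"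
    using measurable_compose[OF _ FM, of ?sp lborel] sp by simp
  have sphere: "sphere_measure = distr (density lborel (\<lambda>p. ennreal (?g p))) (restrict_space borel S2) ?sp"
    unfolding sphere_measure_def
    by (intro arg_cong2[where f = "\<lambda>d s. distr d (restrict_space borel S2) s"]
        arg_cong[where f = "density lborel"])
      (auto simp: fun_eq_iff indicator_def)
  have "integrable lborel (\<lambda>p. indicator ?box p *\<^sub>R (sin (fst p) *\<^sub>R F (?sp p)))"
    by (intro borel_integrable_compact compact_Times continuous_intros Fsp) auto
  then show int: "integrable lborel (\<lambda>p. ?g p *\<^sub>R F (?sp p))"
    by (simp add: mult.commute)
  show "integrable sphere_measure F"
    unfolding sphere integrable_distr_eq[OF sp FM] integrable_density[OF Fsp_meas g_meas g_nonneg]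
    by (rule int)
  show "(LINT \<omega>|sphere_measure. F \<omega>) = (LINT p|lborel. ?g p *\<^sub>R F (?sp p))"
    unfolding sphere integral_distr[OF sp FM] integral_density[OF Fsp_meas g_meas g_nonneg] ..
qed

lemma finite_measure_sphere_measure: "finite_measure sphere_measure"
  using integrable_sphere_measure[of "\<lambda>_. 1 :: real"]
  by (intro finite_measureI) (simp add: integrable_iff_bounded)

lemma L2_space_sphere_measure:
  assumes "continuous_on S2 F"
  shows "F \<in> L2_space sphere_measure"
proof -
  have "F \<in> borel_measurable (restrict_space borel S2)"
    using assms by (rule borel_measurable_continuous_on_restrict)
  moreover have "measurable sphere_measure (borel :: complex measure) = measurable (restrict_space borel S2) borel"
    by (rule measurable_cong_sets) auto
  ultimately show ?thesis
    using assms by (auto simp: L2_space_iff intro!: integrable_sphere_measure continuous_intros)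
qed

text \<open>On the sphere \<open>e^(i m \<phi>) sin^n \<theta>\<close> with \<open>n = \<bar>m\<bar>\<close> is the polynomial \<open>(x \<plusminus> i y)^n\<close>.\<close>

definition sph_xy :: "int \<Rightarrow> real ^ 3 \<Rightarrow> complex" where
  "sph_xy m \<omega> =
     (if 0 \<le> m then Complex (\<omega> $ 1) (\<omega> $ 2) else Complex (\<omega> $ 1) (- (\<omega> $ 2))) ^ nat \<bar>m\<bar>"

definition sph_generator :: "int \<Rightarrow> real poly \<Rightarrow> real ^ 3 \<Rightarrow> complex" where
  "sph_generator m p \<omega> = sph_xy m \<omega> * of_real (poly p (\<omega> $ 3))"

text \<open>The constant left once the power of \<open>x \<plusminus> i y\<close> is split off. For
  \<open>m < 0\<close> the Condon--Shortley sign cancels the sign of the negative-order formula, and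
  the factor \<open>(l - n)! / (l + n)!\<close> of that formula inverts the quotient under the root,
  so only \<open>\<bar>m\<bar>\<close> enters there.\<close>

definition sph_coeff :: "nat \<Rightarrow> int \<Rightarrow> real" where
  "sph_coeff l m = (if 0 \<le> m then (-1) ^ nat \<bar>m\<bar> else 1) *
     sqrt ((2 * real l + 1) / (4 * pi) * (fact (l - nat \<bar>m\<bar>) / fact (l + nat \<bar>m\<bar>)))"

lemma continuous_sph_generator: "continuous_on A (sph_generator m p)"
  unfolding sph_generator_def[abs_def] sph_xy_def Complex_eq
  by (cases "0 \<le> m") (auto intro!: continuous_intros)

lemma sph_generator_spherical_point:
  "sph_generator m p (spherical_point \<theta> \<phi>) =
    of_real (sin \<theta> ^ nat \<bar>m\<bar> * poly p (cos \<theta>)) * exp (\<i> * of_int m * of_real \<phi>)"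
proof -
  have "sph_xy m (spherical_point \<theta> \<phi>) = of_real (sin \<theta> ^ nat \<bar>m\<bar>) * exp (\<i> * of_int m * of_real \<phi>)"
  proof (cases "0 \<le> m")
    case True
    have "Complex (sin \<theta> * cos \<phi>) (sin \<theta> * sin \<phi>) = of_real (sin \<theta>) * exp (\<i> * of_real \<phi>)"
      by (simp add: complex_eq_iff exp_Euler cos_of_real sin_of_real)
    moreover have "exp (\<i> * of_real \<phi>) ^ nat m = exp (\<i> * of_int m * of_real \<phi>)"
      using True by (simp flip: exp_of_nat_mult add: ac_simps)
    ultimately show ?thesis
      using True by (simp add: sph_xy_def power_mult_distrib)
  next
    case False
    have "Complex (sin \<theta> * cos \<phi>) (- (sin \<theta> * sin \<phi>)) = of_real (sin \<theta>) * exp (- (\<i> * of_real \<phi>))"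
      by (simp add: complex_eq_iff exp_minus_Euler cos_of_real sin_of_real)
    moreover have "exp (- (\<i> * of_real \<phi>)) ^ nat (- m) = exp (\<i> * of_int m * of_real \<phi>)"
      using False by (simp flip: exp_of_nat_mult add: ac_simps)
    ultimately show ?thesis
      using False by (simp add: sph_xy_def power_mult_distrib)
  qed
  then show ?thesis
    by (simp add: sph_generator_def)
qed

text \<open>With \<open>\<zeta> = x + i y\<close> the sine of the polar angle is
  \<open>|\<zeta>|\<close>, so \<open>sin^n \<theta> e^(i m \<phi>)\<close> is a power of
  \<open>\<zeta>\<close> or of its conjugate. The polar decomposition of \<open>\<zeta>\<close> also
  holds at the poles, where \<open>\<zeta> = 0\<close>, so the jump and the convention of
  \<open>azimuth\<close> both disappear.\<close>

lemma sph_harm_eq_generator: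
  assumes m: "\<bar>m\<bar> \<le> int l" and \<omega>: "\<omega> \<in> S2"
  shows "sph_harm l m \<omega> =
    of_real (sph_coeff l m) * sph_generator m ((pderiv ^^ nat \<bar>m\<bar>) (legendre_poly l)) \<omega>"
proof -
  define n where "n = nat \<bar>m\<bar>"
  define \<zeta> where "\<zeta> = Complex (\<omega> $ 1) (\<omega> $ 2)"
  have xyz: "(\<omega> $ 1)\<^sup>2 + (\<omega> $ 2)\<^sup>2 + (\<omega> $ 3)\<^sup>2 = 1"
    using \<omega> by (rule S2_coordinates)
  have "(\<omega> $ 3)\<^sup>2 \<le> 1"
    using xyz zero_le_power2[of "\<omega> $ 1"] zero_le_power2[of "\<omega> $ 2"] by linarith
  then have "\<bar>\<omega> $ 3\<bar> \<le> 1"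
    by (simp add: abs_square_le_1)
  then have cos: "cos (polar_angle \<omega>) = \<omega> $ 3"
    by (simp add: polar_angle_def abs_le_iff)
  have r: "sqrt (1 - (\<omega> $ 3)\<^sup>2) = cmod \<zeta>"
    using xyz by (simp add: cmod_def \<zeta>_def)
  have \<zeta>: "\<zeta> = of_real (cmod \<zeta>) * exp (\<i> * of_real (azimuth \<omega>))"
    unfolding azimuth_def \<zeta>_def by (rule Arg2pi_eq)
  have xy: "exp (\<i> * of_int m * of_real (azimuth \<omega>)) * of_real (cmod \<zeta> ^ n) = sph_xy m \<omega>"
  proof (cases "0 \<le> m")
    case True
    have "sph_xy m \<omega> = \<zeta> ^ n"
      using True by (simp add: sph_xy_def \<zeta>_def n_def)
    also have "\<dots> = of_real (cmod \<zeta> ^ n) * exp (\<i> * of_real (azimuth \<omega>)) ^ n"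
      by (subst \<zeta>) (simp add: power_mult_distrib)
    also have "exp (\<i> * of_real (azimuth \<omega>)) ^ n = exp (\<i> * of_int m * of_real (azimuth \<omega>))"
      using True by (simp flip: exp_of_nat_mult add: ac_simps n_def)
    finally show ?thesis by simp
  next
    case False
    have "sph_xy m \<omega> = cnj \<zeta> ^ n"
      using False by (simp add: sph_xy_def \<zeta>_def n_def complex_cnj)
    also have "cnj \<zeta> = of_real (cmod \<zeta>) * exp (- (\<i> * of_real (azimuth \<omega>)))"
      by (subst \<zeta>) (simp add: exp_cnj)
    also have "\<dots> ^ n = of_real (cmod \<zeta> ^ n) * exp (- (\<i> * of_real (azimuth \<omega>))) ^ n"
      by (simp add: power_mult_distrib)
    also have "exp (- (\<i> * of_real (azimuth \<omega>))) ^ n = exp (\<i> * of_int m * of_real (azimuth \<omega>))"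
      using False by (simp flip: exp_of_nat_mult add: ac_simps n_def)
    finally show ?thesis by simp
  qed
  let ?P = "poly ((pderiv ^^ n) (legendre_poly l)) (\<omega> $ 3)"
  have "sph_norm_const l m * assoc_legendre l m (\<omega> $ 3) = sph_coeff l m * cmod \<zeta> ^ n * ?P"
  proof (cases "0 \<le> m")
    case True
    then have "nat (int l - m) = l - n" "nat (int l + m) = l + n" "nat m = n"
      by (auto simp: n_def)
    then show ?thesis
      using True by (simp add: sph_norm_const_def assoc_legendre_def sph_coeff_def r Let_def flip: n_def)
  next
    case False
    then have nat: "nat (int l - m) = l + n" "nat (int l + m) = l - n" "nat (- m) = n"
      using m False by (auto simp: n_def)
    define a b s :: real where "a = fact (l - n)" and "b = fact (l + n)" and "s = (2 * real l + 1) / (4 * pi)"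
    have "sqrt (s * (b / a)) * (a / b) = sqrt (s * (a / b))"
    proof -
      have ab: "0 < a" "0 < b"
        by (simp_all add: a_def b_def)
      then have "a / b = sqrt ((a / b) * (a / b))"
        by (simp only: real_sqrt_abs2) simp
      then have "sqrt (s * (b / a)) * (a / b) = sqrt (s * (b / a) * ((a / b) * (a / b)))"
        by (metis real_sqrt_mult)
      then show ?thesis
        using ab by simp
    qed
    moreover have "sph_norm_const l m = sqrt (s * (b / a))"
      by (simp only: sph_norm_const_def nat a_def b_def s_def)
    moreover have "sph_coeff l m = sqrt (s * (a / b))"
      using False by (simp only: sph_coeff_def n_def[symmetric] a_def b_def s_def if_False mult_1_left)
    moreover have "assoc_legendre l m (\<omega> $ 3) = a / b * (cmod \<zeta> ^ n * ?P)"
    proof -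
      have "assoc_legendre l m (\<omega> $ 3) = (-1) ^ n * (a / b) * ((-1) ^ n * cmod \<zeta> ^ n * ?P)"
        using False by (simp only: assoc_legendre_def Let_def n_def[symmetric] r a_def b_def if_False)
      also have "\<dots> = ((-1) ^ n * (-1) ^ n) * (a / b * (cmod \<zeta> ^ n * ?P))"
        by (simp only: mult.assoc mult.left_commute)
      also have "(-1) ^ n * (-1) ^ n = (1 :: real)"
        by (simp flip: power_mult_distrib)
      finally show ?thesis by simp
    qed
    ultimately show ?thesis
      by (metis mult.assoc)
  qed
  then have "of_real (sph_norm_const l m) * of_real (assoc_legendre l m (\<omega> $ 3))
      = (of_real (sph_coeff l m * cmod \<zeta> ^ n * ?P) :: complex)"
    by (simp only: of_real_mult[symmetric])
  moreover have "sph_harm l m \<omega> = of_real (sph_norm_const l m) * of_real (assoc_legendre l m (\<omega> $ 3))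
      * exp (\<i> * of_int m * of_real (azimuth \<omega>))"
    unfolding sph_harm_def cos by (simp only: ac_simps)
  ultimately show ?thesis
    unfolding sph_generator_def xy[symmetric] n_def[symmetric] by simp
qed

lemma continuous_sph_harm:
  assumes "\<bar>m\<bar> \<le> int l"
  shows "continuous_on S2 (sph_harm l m)"
proof -
  have "continuous_on S2 (\<lambda>\<omega>. of_real (sph_coeff l m) * sph_generator m ((pderiv ^^ nat \<bar>m\<bar>) (legendre_poly l)) \<omega>)"
    by (intro continuous_intros continuous_sph_generator)
  then show ?thesis
    by (rule continuous_on_eq) (simp add: sph_harm_eq_generator[OF assms] del: mem_sphere_0)
qed

lemma integral_exp_int:
  "(LINT \<phi>|lborel. indicator {0..2 * pi} \<phi> *\<^sub>R exp (\<i> * of_int k * of_real \<phi>)) = (if k = 0 then 2 * pi else 0)"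
proof (cases "k = 0")
  case True
  then show ?thesis by (simp add: scaleR_conv_of_real)
next
  case False
  let ?F = "\<lambda>\<phi>. exp (\<i> * of_int k * complex_of_real \<phi>) / (\<i> * of_int k)"
  have deriv: "(?F has_vector_derivative exp (\<i> * of_int k * of_real \<phi>)) (at \<phi> within A)" for \<phi> A
    using False by (auto intro!: derivative_eq_intros has_vector_derivative_real_field)
  have "(LINT \<phi>|lborel. indicator {0..2 * pi} \<phi> *\<^sub>R exp (\<i> * of_int k * of_real \<phi>)) = ?F (2 * pi) - ?F 0"
    by (rule integral_FTC_Icc) (auto intro!: continuous_intros deriv)
  moreover have "exp (\<i> * of_int k * complex_of_real (2 * pi)) = 1"
    using exp_eq_1[of "\<i> * of_int k * complex_of_real (2 * pi)"] by auto
  ultimately show ?thesis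
    using False by simp
qed

text \<open>The integrand is a product of a function of \<open>\<theta>\<close> and
  \<open>e^(i (m - m') \<phi>)\<close>. The azimuthal integral forces \<open>m = m'\<close>, and
  then the exponent of \<open>sin \<theta>\<close> is even, so \<open>sin^2 = 1 - cos^2\<close>
  produces the polynomial weight.\<close>

lemma L2_inner_sph_generator:
  "L2_inner sphere_measure (sph_generator m p) (sph_generator m' q) =
    (if m = m' then of_real (2 * pi * cos_integral ([:1, 0, -1:] ^ nat \<bar>m\<bar> * p * q)) else 0)"
proof -
  let ?F = "\<lambda>\<omega>. sph_generator m p \<omega> * cnj (sph_generator m' q \<omega>)"
  let ?n = "nat \<bar>m\<bar> + nat \<bar>m'\<bar>"
  let ?A = "\<lambda>\<theta>. (sin \<theta> ^ ?n * poly p (cos \<theta>) * poly q (cos \<theta>) * sin \<theta>) * indicator {0..pi} \<theta>"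
  let ?B = "\<lambda>\<phi>. indicator {0..2 * pi} \<phi> *\<^sub>R exp (\<i> * of_int (m - m') * of_real \<phi>)"
  let ?G = "\<lambda>p. (sin (fst p) * indicator ({0..pi} \<times> {0..2 * pi}) p) *\<^sub>R ?F (spherical_point (fst p) (snd p))"
  have F: "continuous_on S2 ?F"
    by (intro continuous_intros continuous_sph_generator)
  have split: "?G (\<theta>, \<phi>) = of_real (?A \<theta>) * ?B \<phi>" for \<theta> \<phi>
  proof -
    have "exp (\<i> * of_int m * of_real \<phi>) * cnj (exp (\<i> * of_int m' * of_real \<phi>))
        = exp (\<i> * of_int (m - m') * of_real \<phi>)"
      by (simp add: exp_cnj algebra_simps flip: exp_add)
    then have "?F (spherical_point \<theta> \<phi>) = of_real (sin \<theta> ^ ?n * poly p (cos \<theta>) * poly q (cos \<theta>))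
        * exp (\<i> * of_int (m - m') * of_real \<phi>)"
      unfolding sph_generator_spherical_point
      by (simp add: power_add ac_simps)
    then show ?thesis
      by (simp add: indicator_times scaleR_conv_of_real)
  qed
  have "L2_inner sphere_measure (sph_generator m p) (sph_generator m' q) = (LINT p|lborel. ?G p)"
    unfolding L2_inner_def by (rule integral_sphere_measure[OF F])
  also have "\<dots> = (LINT \<theta>|lborel. LINT \<phi>|lborel. ?G (\<theta>, \<phi>))"
    using integrable_sphere_coordinates[OF F] unfolding lborel_prod[symmetric]
    by (rule lborel_pair.integral_fst'[symmetric])
  also have "\<dots> = (LINT \<theta>|lborel. of_real (?A \<theta>) * (LINT \<phi>|lborel. ?B \<phi>))"
    unfolding split integral_mult_right_zero ..
  also have "\<dots> = of_real (LINT \<theta>|lborel. ?A \<theta>) * (LINT \<phi>|lborel. ?B \<phi>)"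
    unfolding integral_mult_left_zero integral_complex_of_real ..
  finally have *: "L2_inner sphere_measure (sph_generator m p) (sph_generator m' q)
      = of_real (LINT \<theta>|lborel. ?A \<theta>) * (if m = m' then 2 * pi else 0)"
    unfolding integral_exp_int by simp
  show ?thesis
  proof (cases "m = m'")
    case True
    have "(LINT \<theta>|lborel. ?A \<theta>) = cos_integral ([:1, 0, -1:] ^ nat \<bar>m\<bar> * p * q)"
      unfolding cos_integral_def
    proof (rule Bochner_Integration.integral_cong)
      fix \<theta> :: real
      have "sin \<theta> ^ ?n = (1 - cos \<theta> * cos \<theta>) ^ nat \<bar>m\<bar>"
        unfolding True power_add power_mult_distrib[symmetric]
        using sin_squared_eq[of \<theta>] by (simp add: power2_eq_square)
      then show "?A \<theta> = poly ([:1, 0, -1:] ^ nat \<bar>m\<bar> * p * q) (cos \<theta>) * sin \<theta> * indicator {0..pi} \<theta>"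
        by simp
    qed simp
    then show ?thesis
      using True * by simp
  qed (use * in simp)
qed

definition harmonic_indices :: "(nat \<times> int) set" where
  "harmonic_indices = {(l, m). \<bar>m\<bar> \<le> int l}"

lemma sph_coeff_nonzero: "sph_coeff l m \<noteq> 0"
  by (auto simp: sph_coeff_def)

definition sph_basis :: "nat \<times> int \<Rightarrow> real ^ 3 \<Rightarrow> complex" where
  "sph_basis p = sph_harm (fst p) (snd p)"

lemma sph_basis_orthonormal: "L2_orthonormal sphere_measure harmonic_indices sph_basis"
proof -
  have "L2_inner sphere_measure (sph_harm l m) (sph_harm l' m') = of_bool ((l, m) = (l', m'))"
    if m: "\<bar>m\<bar> \<le> int l" and m': "\<bar>m'\<bar> \<le> int l'" for l m l' m'
  proof -
    define n where "n = nat \<bar>m\<bar>"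
    have "L2_inner sphere_measure (sph_harm l m) (sph_harm l' m') =
        L2_inner sphere_measure
          (\<lambda>\<omega>. of_real (sph_coeff l m) * sph_generator m ((pderiv ^^ nat \<bar>m\<bar>) (legendre_poly l)) \<omega>)
          (\<lambda>\<omega>. of_real (sph_coeff l' m') * sph_generator m' ((pderiv ^^ nat \<bar>m'\<bar>) (legendre_poly l')) \<omega>)"
      by (intro L2_inner_cong)
         (simp_all add: sph_harm_eq_generator[OF m] sph_harm_eq_generator[OF m'] del: mem_sphere_0)
    also have "\<dots> = (if m = m' then of_real (sph_coeff l m * sph_coeff l' m * (2 * pi * legendre_integral n l l')) else 0)"
      unfolding L2_inner_cmult_left L2_inner_cmult_right L2_inner_sph_generator
      by (simp add: legendre_integral_def n_def)
    also have "\<dots> = of_bool ((l, m) = (l', m'))"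
    proof (cases "l = l' \<and> m = m'")
      case True
      have "(sph_coeff l m)\<^sup>2 = (2 * real l + 1) / (4 * pi) * (fact (l - n) / fact (l + n))"
        by (simp add: sph_coeff_def power_mult_distrib n_def flip: power_mult)
      moreover have "2 * real l + 1 \<noteq> 0"
        by linarith
      \<comment> \<open>The azimuth contributes \<open>2 \<pi>\<close> and the Legendre norm
        \<open>2 / (2 l + 1)\<close>; their product is the inverse of
        \<open>(2 l + 1) / (4 \<pi>)\<close>, and the factorial quotients are reciprocal.\<close>
      ultimately have "sph_coeff l m * sph_coeff l m * (2 * pi * legendre_integral n l l) = 1"
        using m by (simp add: legendre_integral_eq n_def flip: power2_eq_square)
      then show ?thesis using True by simp
    qed (auto simp: legendre_integral_eq)
    finally show ?thesis .
  qed
  then show ?thesis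
    by (auto simp: L2_orthonormal_def harmonic_indices_def sph_basis_def
        intro!: L2_space_sphere_measure continuous_sph_harm)
qed


section \<open>Completeness of the spherical harmonics\<close>

text \<open>Equality is asked for on \<open>S2\<close> only: the closure under multiplication by
  coordinates relies on \<open>x^2 + y^2 = 1 - z^2\<close>.\<close>

definition sph_span :: "(real ^ 3 \<Rightarrow> complex) set" where
  "sph_span = {f. \<exists>P c. finite P \<and> P \<subseteq> harmonic_indices \<and>
     (\<forall>\<omega>\<in>S2. f \<omega> = (\<Sum>p\<in>P. c p * sph_basis p \<omega>))}"

lemma sph_span_cong:
  assumes "f \<in> sph_span" "\<And>\<omega>. \<omega> \<in> S2 \<Longrightarrow> f \<omega> = g \<omega>"
  shows "g \<in> sph_span"
  using assms by (simp add: sph_span_def del: mem_sphere_0)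

lemma sph_span_cmult:
  assumes "f \<in> sph_span"
  shows "(\<lambda>\<omega>. a * f \<omega>) \<in> sph_span"
proof -
  obtain P c where P: "finite P" "P \<subseteq> harmonic_indices"
    and f: "\<And>\<omega>. \<omega> \<in> S2 \<Longrightarrow> f \<omega> = (\<Sum>p\<in>P. c p * sph_basis p \<omega>)"
    using assms unfolding sph_span_def by blast
  have "a * f \<omega> = (\<Sum>p\<in>P. (a * c p) * sph_basis p \<omega>)" if "\<omega> \<in> S2" for \<omega>
    unfolding f[OF that] sum_distrib_left by (simp add: mult.assoc)
  then show ?thesis
    unfolding sph_span_def using P by (intro CollectI exI[of _ P] exI[of _ "\<lambda>p. a * c p"]) auto
qed

lemma sph_span_add:
  assumes "f \<in> sph_span" "g \<in> sph_span"
  shows "(\<lambda>\<omega>. f \<omega> + g \<omega>) \<in> sph_span"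
proof -
  obtain P c where P: "finite P" "P \<subseteq> harmonic_indices"
    and f: "\<And>\<omega>. \<omega> \<in> S2 \<Longrightarrow> f \<omega> = (\<Sum>p\<in>P. c p * sph_basis p \<omega>)"
    using assms(1) unfolding sph_span_def by blast
  obtain Q d where Q: "finite Q" "Q \<subseteq> harmonic_indices"
    and g: "\<And>\<omega>. \<omega> \<in> S2 \<Longrightarrow> g \<omega> = (\<Sum>p\<in>Q. d p * sph_basis p \<omega>)"
    using assms(2) unfolding sph_span_def by blast
  let ?e = "\<lambda>p. (if p \<in> P then c p else 0) + (if p \<in> Q then d p else 0)"
  have "f \<omega> + g \<omega> = (\<Sum>p\<in>P \<union> Q. ?e p * sph_basis p \<omega>)" if "\<omega> \<in> S2" for \<omega>
  proof -
    have "f \<omega> = (\<Sum>p\<in>P \<union> Q. (if p \<in> P then c p else 0) * sph_basis p \<omega>)"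
      unfolding f[OF that] using P Q by (intro sum.mono_neutral_cong_left) auto
    moreover have "g \<omega> = (\<Sum>p\<in>P \<union> Q. (if p \<in> Q then d p else 0) * sph_basis p \<omega>)"
      unfolding g[OF that] using P Q by (intro sum.mono_neutral_cong_left) auto
    ultimately show ?thesis
      by (simp add: distrib_right sum.distrib)
  qed
  then show ?thesis
    unfolding sph_span_def using P Q by (intro CollectI exI[of _ "P \<union> Q"] exI[of _ ?e]) auto
qed

lemma sph_span_zero: "(\<lambda>\<omega>. 0) \<in> sph_span"
  unfolding sph_span_def by (intro CollectI exI[of _ "{}"]) auto

lemma sph_span_sum:
  assumes "\<And>i. i \<in> A \<Longrightarrow> F i \<in> sph_span"
  shows "(\<lambda>\<omega>. \<Sum>i\<in>A. F i \<omega>) \<in> sph_span"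
  using assms
  by (induction A rule: infinite_finite_induct) (auto intro: sph_span_zero sph_span_add)

lemma sph_harm_in_span: "\<bar>m\<bar> \<le> int l \<Longrightarrow> sph_harm l m \<in> sph_span"
  unfolding sph_span_def
  by (intro CollectI exI[of _ "{(l, m)}"] exI[of _ "\<lambda>_. 1"]) (auto simp: harmonic_indices_def sph_basis_def)

text \<open>The derivatives \<open>D^n P_l\<close> have degree \<open>l - n\<close>, so for fixed \<open>n\<close> they span all polynomials.\<close>

lemma sph_generator_in_span: "sph_generator m q \<in> sph_span"
proof -
  \<comment> \<open>A bound on the coefficients instead of the degree makes \<open>d = 0\<close>
    mean \<open>q = 0\<close>, a base case that \<open>degree\<close> cannot separate from
    constants.\<close>
  have "sph_generator m q \<in> sph_span" if "\<forall>i\<ge>d. coeff q i = 0" for d q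
    using that
  proof (induction d arbitrary: q)
    case 0
    then have "q = 0"
      by (simp add: poly_eq_iff)
    then show ?case
      using sph_span_zero by (simp add: sph_generator_def[abs_def])
  next
    case (Suc d)
    \<comment> \<open>The degree is chosen so that the \<open>\<bar>m\<bar>\<close>-th derivative of
      the Legendre polynomial has degree exactly \<open>d\<close>; a multiple of it removes the top
      coefficient of \<open>q\<close>.\<close>
    define l where "l = nat \<bar>m\<bar> + d"
    define r where "r = (pderiv ^^ nat \<bar>m\<bar>) (legendre_poly l)"
    have ml: "\<bar>m\<bar> \<le> int l"
      by (simp add: l_def)
    have deg: "degree r = d"
      by (simp add: r_def degree_higher_pderiv_legendre_poly l_def)
    have "r \<noteq> 0"
      unfolding r_def by (rule higher_pderiv_legendre_poly_nonzero) (simp add: l_def)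
    then have lc: "coeff r d \<noteq> 0"
      using deg by auto
    define a where "a = coeff q d / coeff r d"
    have "\<forall>i\<ge>d. coeff (q - smult a r) i = 0"
    proof (intro allI impI)
      fix i assume "d \<le> i"
      then consider "i = d" | "Suc d \<le> i" by linarith
      then show "coeff (q - smult a r) i = 0"
      proof cases
        case 2
        then show ?thesis
          using Suc.prems deg by (simp add: coeff_eq_0)
      qed (use lc in \<open>simp add: a_def\<close>)
    qed
    then have "sph_generator m (q - smult a r) \<in> sph_span"
      by (rule Suc.IH)
    then have "(\<lambda>\<omega>. sph_generator m (q - smult a r) \<omega> + of_real (a / sph_coeff l m) * sph_harm l m \<omega>) \<in> sph_span"
      by (intro sph_span_add sph_span_cmult sph_harm_in_span ml)
    then show ?case
    proof (rule sph_span_cong)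
      fix \<omega> :: "real ^ 3" assume \<omega>: "\<omega> \<in> S2"
      show "sph_generator m (q - smult a r) \<omega> + of_real (a / sph_coeff l m) * sph_harm l m \<omega> = sph_generator m q \<omega>"
        using sph_coeff_nonzero[of l m]
        by (simp add: sph_harm_eq_generator[OF ml \<omega>] sph_generator_def algebra_simps flip: r_def)
    qed
  qed
  moreover have "\<forall>i\<ge>Suc (degree q). coeff q i = 0"
    by (simp add: coeff_eq_0)
  ultimately show ?thesis
    by blast
qed

text \<open>Multiplying a single harmonic by a coordinate would call for the three-term recursions
  of Legendre functions. A generator carries an arbitrary polynomial in \<open>z\<close>, so there
  the product can be written down directly.\<close>

lemma sph_span_multI:
  assumes f: "f \<in> sph_span"
    and gen: "\<And>m q. (\<lambda>\<omega>. h \<omega> * sph_generator m q \<omega>) \<in> sph_span"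
  shows "(\<lambda>\<omega>. h \<omega> * f \<omega>) \<in> sph_span"
proof -
  obtain P c where P: "P \<subseteq> harmonic_indices"
    and f: "\<And>\<omega>. \<omega> \<in> S2 \<Longrightarrow> f \<omega> = (\<Sum>p\<in>P. c p * sph_basis p \<omega>)"
    using f unfolding sph_span_def by blast
  let ?g = "\<lambda>p. sph_generator (snd p) ((pderiv ^^ nat \<bar>snd p\<bar>) (legendre_poly (fst p)))"
  have "(\<lambda>\<omega>. \<Sum>p\<in>P. (c p * of_real (sph_coeff (fst p) (snd p))) * (h \<omega> * ?g p \<omega>)) \<in> sph_span"
    by (intro sph_span_sum sph_span_cmult gen)
  then show ?thesis
  proof (rule sph_span_cong)
    fix \<omega> :: "real ^ 3" assume \<omega>: "\<omega> \<in> S2"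
    have "sph_basis p \<omega> = of_real (sph_coeff (fst p) (snd p)) * ?g p \<omega>" if "p \<in> P" for p
      unfolding sph_basis_def using that P \<omega> by (intro sph_harm_eq_generator) (auto simp: harmonic_indices_def)
    then show "(\<Sum>p\<in>P. (c p * of_real (sph_coeff (fst p) (snd p))) * (h \<omega> * ?g p \<omega>)) = h \<omega> * f \<omega>"
      unfolding f[OF \<omega>] sum_distrib_left
      by (intro sum.cong) auto
  qed
qed

lemma sph_span_mult_z:
  assumes "f \<in> sph_span"
  shows "(\<lambda>\<omega>. of_real (\<omega> $ 3) * f \<omega>) \<in> sph_span"
proof (rule sph_span_multI[OF assms])
  fix m q
  show "(\<lambda>\<omega>. of_real (\<omega> $ 3) * sph_generator m q \<omega>) \<in> sph_span"
    by (rule sph_span_cong[OF sph_generator_in_span[of m "[:0, 1:] * q"]]) (simp add: sph_generator_def)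
qed

lemma S2_complex_norm: "\<omega> \<in> S2 \<Longrightarrow>
    Complex (\<omega> $ 1) (\<omega> $ 2) * Complex (\<omega> $ 1) (- (\<omega> $ 2)) = of_real (1 - \<omega> $ 3 * \<omega> $ 3)"
  using S2_coordinates[of \<omega>] by (simp add: complex_eq_iff power2_eq_square)

text \<open>Multiplication by \<open>x + i y\<close> raises the order by one. For negative orders it
  meets a factor \<open>x - i y\<close>, and the product of the two is \<open>1 - z^2\<close>, which
  is absorbed into the polynomial.\<close>

lemma sph_span_mult_xy:
  assumes "f \<in> sph_span"
  shows "(\<lambda>\<omega>. Complex (\<omega> $ 1) (\<omega> $ 2) * f \<omega>) \<in> sph_span"
proof (rule sph_span_multI[OF assms])
  fix m q
  show "(\<lambda>\<omega>. Complex (\<omega> $ 1) (\<omega> $ 2) * sph_generator m q \<omega>) \<in> sph_span"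
  proof (cases "0 \<le> m")
    case True
    then have "nat \<bar>m + 1\<bar> = Suc (nat \<bar>m\<bar>)" by simp
    then show ?thesis
      using True
      by (intro sph_span_cong[OF sph_generator_in_span[of "m + 1" q]])
         (simp add: sph_generator_def sph_xy_def)
  next
    case False
    then have n: "nat \<bar>m\<bar> = Suc (nat \<bar>m + 1\<bar>)" by simp
    show ?thesis
    proof (rule sph_span_cong[OF sph_generator_in_span[of "m + 1" "[:1, 0, -1:] * q"]])
      fix \<omega> :: "real ^ 3" assume \<omega>: "\<omega> \<in> S2"
      \<comment> \<open>At \<open>m = -1\<close> the order \<open>m + 1 = 0\<close> selects the
        other branch of \<open>sph_xy\<close>, but the exponent is 0 and both branches give
        1.\<close>
      have xy: "sph_xy (m + 1) \<omega> = Complex (\<omega> $ 1) (- (\<omega> $ 2)) ^ nat \<bar>m + 1\<bar>"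
        using False by (cases "m = -1") (auto simp: sph_xy_def)
      have "Complex (\<omega> $ 1) (\<omega> $ 2) * sph_generator m q \<omega> =
          (Complex (\<omega> $ 1) (\<omega> $ 2) * Complex (\<omega> $ 1) (- (\<omega> $ 2))) * (sph_xy (m + 1) \<omega> * of_real (poly q (\<omega> $ 3)))"
        using False unfolding sph_generator_def xy unfolding sph_xy_def n by (simp only: if_False power_Suc mult.assoc)
      also have "\<dots> = sph_generator (m + 1) ([:1, 0, -1:] * q) \<omega>"
        unfolding S2_complex_norm[OF \<omega>] by (simp add: sph_generator_def algebra_simps)
      finally show "sph_generator (m + 1) ([:1, 0, -1:] * q) \<omega> = Complex (\<omega> $ 1) (\<omega> $ 2) * sph_generator m q \<omega>" ..
    qed
  qed
qed

lemma sph_span_mult_cnj_xy: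
  assumes "f \<in> sph_span"
  shows "(\<lambda>\<omega>. Complex (\<omega> $ 1) (- (\<omega> $ 2)) * f \<omega>) \<in> sph_span"
proof (rule sph_span_multI[OF assms])
  fix m q
  show "(\<lambda>\<omega>. Complex (\<omega> $ 1) (- (\<omega> $ 2)) * sph_generator m q \<omega>) \<in> sph_span"
  \<comment> \<open>The split is at \<open>0 < m\<close> because \<open>m = 0\<close> behaves like
    the negative orders: \<open>m - 1\<close> is negative and the power of \<open>x - i y\<close>
    grows.\<close>
  proof (cases "0 < m")
    case False
    then have n: "nat \<bar>m - 1\<bar> = Suc (nat \<bar>m\<bar>)" by simp
    show ?thesis
    proof (rule sph_span_cong[OF sph_generator_in_span[of "m - 1" q]])
      fix \<omega> :: "real ^ 3"
      have "sph_xy m \<omega> = Complex (\<omega> $ 1) (- (\<omega> $ 2)) ^ nat \<bar>m\<bar>"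
        using False by (cases "m = 0") (auto simp: sph_xy_def)
      then show "sph_generator (m - 1) q \<omega> = Complex (\<omega> $ 1) (- (\<omega> $ 2)) * sph_generator m q \<omega>"
        using False n by (simp add: sph_generator_def sph_xy_def)
    qed
  next
    case True
    then have n: "nat \<bar>m\<bar> = Suc (nat \<bar>m - 1\<bar>)" by simp
    show ?thesis
    proof (rule sph_span_cong[OF sph_generator_in_span[of "m - 1" "[:1, 0, -1:] * q"]])
      fix \<omega> :: "real ^ 3" assume \<omega>: "\<omega> \<in> S2"
      have xy: "sph_xy (m - 1) \<omega> = Complex (\<omega> $ 1) (\<omega> $ 2) ^ nat \<bar>m - 1\<bar>"
        using True by (simp add: sph_xy_def)
      have m: "(0 \<le> m) = True"
        using True by simp
      have "Complex (\<omega> $ 1) (- (\<omega> $ 2)) * sph_generator m q \<omega> =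
          (Complex (\<omega> $ 1) (\<omega> $ 2) * Complex (\<omega> $ 1) (- (\<omega> $ 2))) * (sph_xy (m - 1) \<omega> * of_real (poly q (\<omega> $ 3)))"
        unfolding sph_generator_def xy unfolding sph_xy_def n m by (simp only: if_True power_Suc mult.assoc mult.left_commute)
      also have "\<dots> = sph_generator (m - 1) ([:1, 0, -1:] * q) \<omega>"
        unfolding S2_complex_norm[OF \<omega>] by (simp add: sph_generator_def algebra_simps)
      finally show "sph_generator (m - 1) ([:1, 0, -1:] * q) \<omega> = Complex (\<omega> $ 1) (- (\<omega> $ 2)) * sph_generator m q \<omega>" ..
    qed
  qed
qed

lemma sph_span_mult_component:
  assumes f: "f \<in> sph_span"
  shows "(\<lambda>\<omega>. of_real (\<omega> $ i) * f \<omega>) \<in> sph_span"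
proof -
  consider "i = 1" | "i = 2" | "i = 3"
    using exhaust_3[of i] by blast
  then show ?thesis
  proof cases
    case 1
    have "(\<lambda>\<omega>. (1 / 2) * (Complex (\<omega> $ 1) (\<omega> $ 2) * f \<omega>) + (1 / 2) * (Complex (\<omega> $ 1) (- (\<omega> $ 2)) * f \<omega>)) \<in> sph_span"
      by (intro sph_span_add sph_span_cmult sph_span_mult_xy sph_span_mult_cnj_xy f)
    then show ?thesis
      by (rule sph_span_cong) (simp add: 1 Complex_eq algebra_simps)
  next
    case 2
    have "(\<lambda>\<omega>. (- \<i> / 2) * (Complex (\<omega> $ 1) (\<omega> $ 2) * f \<omega>) + (\<i> / 2) * (Complex (\<omega> $ 1) (- (\<omega> $ 2)) * f \<omega>)) \<in> sph_span"
      by (intro sph_span_add sph_span_cmult sph_span_mult_xy sph_span_mult_cnj_xy f)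
    then show ?thesis
      by (rule sph_span_cong) (simp add: 2 Complex_eq algebra_simps)
  next
    case 3
    then show ?thesis
      using sph_span_mult_z[OF f] by simp
  qed
qed

text \<open>Stated for multiplication with \<open>f\<close> arbitrary, the product case is two
  successive multiplications; stated as membership of \<open>p\<close> it would ask for closure of
  the span under products.\<close>

lemma sph_span_mult_polynomial:
  assumes "real_polynomial_function p" "f \<in> sph_span"
  shows "(\<lambda>\<omega>. of_real (p \<omega>) * f \<omega>) \<in> sph_span"
  using assms
proof (induction p arbitrary: f rule: real_polynomial_function.induct)
  case (linear h)
  have span: "(\<lambda>\<omega>. \<Sum>i\<in>UNIV. of_real (h (axis i 1)) * (of_real (\<omega> $ i) * f \<omega>)) \<in> sph_span"
    by (intro sph_span_sum sph_span_cmult sph_span_mult_component linear)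
  have h: "h \<omega> = (\<Sum>i\<in>UNIV. \<omega> $ i * h (axis i 1))" for \<omega>
  proof -
    interpret bounded_linear h by (rule linear)
    have "h \<omega> = h (\<Sum>i\<in>UNIV. \<omega> $ i *\<^sub>R axis i 1)"
      by (simp add: basis_expansion flip: scalar_mult_eq_scaleR)
    then show ?thesis
      by (simp add: sum scaleR)
  qed
  show ?case
  proof (rule sph_span_cong[OF span])
    fix \<omega>
    show "(\<Sum>i\<in>UNIV. of_real (h (axis i 1)) * (of_real (\<omega> $ i) * f \<omega>)) = of_real (h \<omega>) * f \<omega>"
      unfolding h[of \<omega>] of_real_sum sum_distrib_right of_real_mult by (simp only: ac_simps)
  qed
next
  case (const c)
  then show ?case by (intro sph_span_cmult)
next
  case (add p q)
  then show ?case by (simp add: distrib_right sph_span_add)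
next
  case (mult p q)
  have "(\<lambda>\<omega>. of_real (p \<omega>) * (of_real (q \<omega>) * f \<omega>)) \<in> sph_span"
    by (intro mult)
  then show ?case by (simp add: mult.assoc)
qed

lemma polynomial_in_sph_span:
  fixes g :: "real ^ 3 \<Rightarrow> complex"
  assumes "polynomial_function g"
  shows "g \<in> sph_span"
proof -
  have one: "(\<lambda>\<omega>. 1) \<in> sph_span"
    using sph_generator_in_span[of 0 "[:1:]"] by (simp add: sph_generator_def[abs_def] sph_xy_def)
  have "real_polynomial_function (\<lambda>\<omega>. Re (g \<omega>))" "real_polynomial_function (\<lambda>\<omega>. Im (g \<omega>))"
    using assms bounded_linear_Re bounded_linear_Im by (auto simp: polynomial_function_def o_def)
  then have "(\<lambda>\<omega>. of_real (Re (g \<omega>)) * 1 + \<i> * (of_real (Im (g \<omega>)) * 1)) \<in> sph_span"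
    by (intro sph_span_add sph_span_cmult sph_span_mult_polynomial one)
  then show ?thesis
    by (rule sph_span_cong) (simp add: complex_eq[symmetric])
qed

lemma continuous_in_sph_span_closure:
  assumes h: "continuous_on S2 h"
  shows "h \<in> L2_closure sphere_measure sph_span"
  unfolding L2_closure_def
proof safe
  interpret finite_measure sphere_measure
    by (rule finite_measure_sphere_measure)
  show hL2: "h \<in> L2_space sphere_measure"
    using h by (rule L2_space_sphere_measure)
  fix e :: real assume "0 < e"
  \<comment> \<open>The added 1 keeps \<open>a\<close> positive and makes
    \<open>area * (e / a) < e\<close> strict.\<close>
  define a where "a = measure sphere_measure S2 + 1"
  have a: "0 < a"
    by (simp add: a_def add_nonneg_pos)
  then have "0 < sqrt (e / a)"
    using \<open>0 < e\<close> by simp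
  from Stone_Weierstrass_polynomial_function[OF compact_sphere h this]
  obtain g where g: "polynomial_function g" "\<forall>\<omega>\<in>S2. cmod (h \<omega> - g \<omega>) < sqrt (e / a)"
    by (elim exE conjE)
  have gL2: "g \<in> L2_space sphere_measure"
    by (intro L2_space_sphere_measure continuous_on_polymonial_function g)
  have "(LINT \<omega>|sphere_measure. (cmod (h \<omega> - g \<omega>))\<^sup>2) \<le> (LINT \<omega>|sphere_measure. e / a)"
  proof (rule integral_mono)
    show "integrable sphere_measure (\<lambda>\<omega>. (cmod (h \<omega> - g \<omega>))\<^sup>2)"
      using L2_space_diff[OF hL2 gL2] by (simp add: L2_space_iff)
    show "(cmod (h \<omega> - g \<omega>))\<^sup>2 \<le> e / a" if "\<omega> \<in> space sphere_measure" for \<omega>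
      using that bspec[OF g(2), of \<omega>] by (intro sqrt_ge_absD) simp
  qed simp
  also have "\<dots> = measure sphere_measure S2 * (e / a)"
    by simp
  also have "\<dots> < a * (e / a)"
    using \<open>0 < e\<close> a by (intro mult_strict_right_mono) (auto simp: a_def)
  finally have "(L2_norm sphere_measure (\<lambda>\<omega>. h \<omega> - g \<omega>))\<^sup>2 < e"
    using a by (simp add: L2_norm_sq_eq_integral)
  then show "\<exists>g\<in>sph_span \<inter> L2_space sphere_measure. (L2_norm sphere_measure (\<lambda>\<omega>. h \<omega> - g \<omega>))\<^sup>2 < e"
    using polynomial_in_sph_span[OF g(1)] gL2 by blast
qed

lemma sph_basis_parseval:
  assumes f: "f \<in> L2_space sphere_measure"
  shows "((\<lambda>p. (cmod (L2_inner sphere_measure f (sph_basis p)))\<^sup>2) has_sum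
    (L2_norm sphere_measure f)\<^sup>2) harmonic_indices"
proof (rule L2_parseval[OF sph_basis_orthonormal])
  let ?V = "{\<lambda>\<omega>. \<Sum>p\<in>P. c p * sph_basis p \<omega> | P c. finite P \<and> P \<subseteq> harmonic_indices}"
  have closure: "f \<in> L2_closure sphere_measure sph_span"
    by (rule L2_dense_if_continuous[OF finite_measure_sphere_measure sets_sphere_measure
          sph_span_add sph_span_cmult continuous_in_sph_span_closure f])
       (auto intro: continuous_on_subset)
  show "f \<in> L2_closure sphere_measure ?V"
    unfolding L2_closure_def
  proof safe
    fix e :: real assume "0 < e"
    then obtain g where g: "g \<in> sph_span" "g \<in> L2_space sphere_measure"
      "(L2_norm sphere_measure (\<lambda>\<omega>. f \<omega> - g \<omega>))\<^sup>2 < e"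
      using closure unfolding L2_closure_def by blast
    then obtain P c where P: "finite P" "P \<subseteq> harmonic_indices"
      and g_eq: "\<And>\<omega>. \<omega> \<in> S2 \<Longrightarrow> g \<omega> = (\<Sum>p\<in>P. c p * sph_basis p \<omega>)"
      unfolding sph_span_def by blast
    \<comment> \<open>\<open>g\<close> equals a combination of harmonics on the sphere only, whereas
      \<open>?V\<close> contains the combinations themselves; \<open>g'\<close> is the
      latter.\<close>
    define g' where "g' = (\<lambda>\<omega>. \<Sum>p\<in>P. c p * sph_basis p \<omega>)"
    have eq: "g \<omega> = g' \<omega>" if "\<omega> \<in> space sphere_measure" for \<omega>
      using that g_eq[of \<omega>] by (simp add: g'_def)
    have "g' \<in> L2_space sphere_measure"
      by (rule L2_space_cong[OF g(2) eq])
    moreover have "(L2_norm sphere_measure (\<lambda>\<omega>. f \<omega> - g' \<omega>))\<^sup>2 < e"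
      using g(3) L2_norm_cong[of sphere_measure "\<lambda>\<omega>. f \<omega> - g \<omega>" "\<lambda>\<omega>. f \<omega> - g' \<omega>"] eq by simp
    moreover have "g' \<in> ?V"
      unfolding g'_def using P by blast
    ultimately show "\<exists>g\<in>?V \<inter> L2_space sphere_measure. (L2_norm sphere_measure (\<lambda>\<omega>. f \<omega> - g \<omega>))\<^sup>2 < e"
      by (intro bexI[of _ g'] IntI)
  qed (rule f)
qed


section \<open>Sampling by scalable frames\<close>

text \<open>Gaussian elimination on the functions \<open>y p\<close>, one pivot point \<open>x0\<close> per step.\<close>

lemma tendsto_coefficients_zero:
  fixes y :: "'i \<Rightarrow> 'a \<Rightarrow> complex"
  assumes "finite P"
    and "\<And>c. (\<forall>x\<in>X. (\<Sum>p\<in>P. c p * y p x) = 0) \<Longrightarrow> \<forall>p\<in>P. c p = 0"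
    and "\<And>x. x \<in> X \<Longrightarrow> ((\<lambda>A. \<Sum>p\<in>P. C p A * y p x) \<longlongrightarrow> 0) F"
  shows "\<forall>p\<in>P. (C p \<longlongrightarrow> 0) F"
  using assms
proof (induction P arbitrary: y rule: finite_induct)
  case (insert r P)
  note indep = insert.prems(1) and lim = insert.prems(2)
  let ?S = "\<lambda>x A. \<Sum>p\<in>insert r P. C p A * y p x"
  have sum_insert: "(\<Sum>p\<in>insert r P. c p * y p x) = c r * y r x + (\<Sum>p\<in>P. c p * y p x)" for c x
    using insert.hyps by (rule sum.insert)
  have "\<exists>x0\<in>X. y r x0 \<noteq> 0"
  proof (rule ccontr)
    assume "\<not> (\<exists>x0\<in>X. y r x0 \<noteq> 0)"
    moreover have "(\<Sum>p\<in>P. (if p = r then 1 else 0) * y p x) = 0" for x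
      using insert.hyps by (intro sum.neutral) auto
    ultimately have "\<forall>x\<in>X. (\<Sum>p\<in>insert r P. (if p = r then 1 else 0) * y p x) = 0"
      unfolding sum_insert by simp
    from indep[OF this] show False by simp
  qed
  then obtain x0 where x0: "x0 \<in> X" "y r x0 \<noteq> 0" by blast
  define z where "z p x = y p x - y p x0 / y r x0 * y r x" for p x
  have z_sum: "(\<Sum>p\<in>P. c p * z p x)
      = (\<Sum>p\<in>P. c p * y p x) - y r x / y r x0 * (\<Sum>p\<in>P. c p * y p x0)" for c x
    by (simp add: z_def right_diff_distrib sum_subtractf sum_distrib_left ac_simps)
  have "\<forall>p\<in>P. (C p \<longlongrightarrow> 0) F"
  proof (rule insert.IH)
    fix c assume c: "\<forall>x\<in>X. (\<Sum>p\<in>P. c p * z p x) = 0"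
    \<comment> \<open>The coefficient at \<open>r\<close> is chosen so that a relation among the
      \<open>z p\<close> becomes one among the \<open>y p\<close> including
      \<open>r\<close>.\<close>
    define c' where "c' = c(r := - (\<Sum>p\<in>P. c p * y p x0) / y r x0)"
    have "(\<Sum>p\<in>P. c' p * y p x) = (\<Sum>p\<in>P. c p * y p x)" for x
      using insert.hyps by (intro sum.cong) (auto simp: c'_def)
    then have "(\<Sum>p\<in>insert r P. c' p * y p x) = (\<Sum>p\<in>P. c p * z p x)" for x
      unfolding sum_insert z_sum by (simp add: c'_def)
    then have "\<forall>p\<in>insert r P. c' p = 0"
      using c by (intro indep) simp
    then show "\<forall>p\<in>P. c p = 0"
      using insert.hyps by (auto simp: c'_def split: if_splits)
  next
    fix x assume x: "x \<in> X"
    have "((\<lambda>A. ?S x A - y r x / y r x0 * ?S x0 A) \<longlongrightarrow> 0 - y r x / y r x0 * 0) F"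
      by (intro tendsto_intros lim x x0)
    moreover have "?S x A - y r x / y r x0 * ?S x0 A = (\<Sum>p\<in>P. C p A * z p x)" for A
      unfolding sum_insert[of "\<lambda>p. C p A"] z_sum using x0 by (simp add: field_simps)
    ultimately show "((\<lambda>A. \<Sum>p\<in>P. C p A * z p x) \<longlongrightarrow> 0) F"
      by simp
  qed
  moreover have "(C r \<longlongrightarrow> 0) F"
  proof -
    \<comment> \<open>Back substitution: at the pivot the full sum and all other coefficients tend
      to 0, so the coefficient of \<open>y r\<close> does too.\<close>
    have "((\<lambda>A. (?S x0 A - (\<Sum>p\<in>P. C p A * y p x0)) / y r x0) \<longlongrightarrow> (0 - (\<Sum>p\<in>P. 0 * y p x0)) / y r x0) F"
      using calculation by (intro tendsto_intros lim x0) auto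
    moreover have "(?S x0 A - (\<Sum>p\<in>P. C p A * y p x0)) / y r x0 = C r A" for A
      unfolding sum_insert[of "\<lambda>p. C p A"] using x0 by simp
    ultimately show ?thesis by simp
  qed
  ultimately show ?case by simp
qed simp

lemma has_sum_sum:
  fixes f :: "'i \<Rightarrow> 'k \<Rightarrow> 'b::topological_comm_monoid_add"
  assumes "\<And>i. i \<in> I \<Longrightarrow> (f i has_sum s i) K"
  shows "((\<lambda>k. \<Sum>i\<in>I. f i k) has_sum (\<Sum>i\<in>I. s i)) K"
  using assms by (induction I rule: infinite_finite_induct) (auto intro: has_sum_add)

section \<open>Discrete orthogonality of the samples\<close>

definition band :: "nat \<Rightarrow> (nat \<times> int) set" where
  "band L = (SIGMA l:{..L}. {- int l..int l})"

lemma finite_band [simp]: "finite (band L)"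
  by (simp add: band_def)

lemma band_subset_harmonic_indices: "band L \<subseteq> harmonic_indices"
  by (auto simp: band_def harmonic_indices_def)

lemma mem_band_iff: "p \<in> harmonic_indices \<Longrightarrow> p \<in> band L \<longleftrightarrow> fst p \<le> L"
  by (auto simp: band_def harmonic_indices_def)

lemma sum_band: "(\<Sum>l\<le>L. \<Sum>m\<in>{- int l..int l}. g l m) = (\<Sum>p\<in>band L. g (fst p) (snd p))"
  unfolding band_def by (subst sum.Sigma) (auto simp: case_prod_unfold)

lemma sph_basis_orthonormal_band: "L2_orthonormal sphere_measure (band L) sph_basis"
  by (rule L2_orthonormal_subset[OF sph_basis_orthonormal band_subset_harmonic_indices])

lemma sph_basis_independent:
  assumes "\<forall>\<omega>\<in>S2. (\<Sum>p\<in>band L. c p * sph_basis p \<omega>) = 0"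
  shows "\<forall>p\<in>band L. c p = 0"
proof
  fix p assume p: "p \<in> band L"
  have "c p = L2_inner sphere_measure (\<lambda>\<omega>. \<Sum>p\<in>band L. c p * sph_basis p \<omega>) (sph_basis p)"
    by (rule L2_orthonormal_sum_inner[OF sph_basis_orthonormal_band finite_band p, symmetric])
  also have "\<dots> = L2_inner sphere_measure (\<lambda>\<omega>. 0) (sph_basis p)"
    using assms by (intro L2_inner_cong) auto
  finally show "c p = 0"
    by (simp add: L2_inner_def)
qed

text \<open>Apply the frame condition to \<open>y q\<close> and expand the kernel: the partial sums
  are combinations of the finitely many \<open>y p\<close>, with the partial sums of the samples as
  coefficients. By linear independence on the sphere, pointwise convergence to \<open>y q\<close>
  forces each coefficient to converge.\<close>

lemma scalable_rk_frame_orthogonality: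
  assumes frame: "scalable_rk_frame L K loc w" and p: "p \<in> band L" and q: "q \<in> band L"
  shows "((\<lambda>k. of_real (w k) * cnj (sph_basis p (loc k)) * sph_basis q (loc k)) has_sum of_bool (p = q)) K"
proof -
  let ?C = "\<lambda>p A. (\<Sum>k\<in>A. of_real (w k) * cnj (sph_basis p (loc k)) * sph_basis q (loc k)) - of_bool (p = q)"
  have expand: "sph_basis q = (\<lambda>\<omega>. \<Sum>p\<in>band L. of_bool (p = q) * sph_basis p \<omega>)"
  proof
    fix \<omega>
    have "(\<Sum>p\<in>band L. of_bool (p = q) * sph_basis p \<omega>) = (\<Sum>p\<in>band L. if p = q then sph_basis q \<omega> else 0)"
      by (intro sum.cong) auto
    then show "sph_basis q \<omega> = (\<Sum>p\<in>band L. of_bool (p = q) * sph_basis p \<omega>)"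
      using q by simp
  qed
  have bl: "sph_basis q \<in> bandlimited L"
    unfolding bandlimited_def sum_band
    by (intro CollectI exI[of _ "\<lambda>l m. of_bool ((l, m) = q)"], subst expand)
       (simp only: sph_basis_def prod.collapse)
  have "\<forall>p\<in>band L. (?C p \<longlongrightarrow> 0) (finite_subsets_at_top K)"
  proof (rule tendsto_coefficients_zero[OF finite_band sph_basis_independent])
    fix \<omega> :: "real ^ 3" assume \<omega>: "\<omega> \<in> S2"
    have "((\<lambda>k. sph_basis q (loc k) * of_real (w k) * repr_kernel L (loc k) \<omega>) has_sum sph_basis q \<omega>) K"
      using frame bl \<omega> unfolding scalable_rk_frame_def by blast
    then have "((\<lambda>A. (\<Sum>k\<in>A. sph_basis q (loc k) * of_real (w k) * repr_kernel L (loc k) \<omega>) - sph_basis q \<omega>)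
        \<longlongrightarrow> sph_basis q \<omega> - sph_basis q \<omega>) (finite_subsets_at_top K)"
      unfolding has_sum_def by (intro tendsto_intros)
    moreover have "(\<Sum>k\<in>A. sph_basis q (loc k) * of_real (w k) * repr_kernel L (loc k) \<omega>) - sph_basis q \<omega>
        = (\<Sum>p\<in>band L. ?C p A * sph_basis p \<omega>)" for A
    proof -
      have "(\<Sum>k\<in>A. sph_basis q (loc k) * of_real (w k) * repr_kernel L (loc k) \<omega>)
          = (\<Sum>k\<in>A. \<Sum>p\<in>band L. of_real (w k) * cnj (sph_basis p (loc k)) * sph_basis q (loc k) * sph_basis p \<omega>)"
        unfolding repr_kernel_def sum_band sph_basis_def[symmetric] sum_distrib_left by (simp only: ac_simps)
      also have "\<dots> = (\<Sum>p\<in>band L. (\<Sum>k\<in>A. of_real (w k) * cnj (sph_basis p (loc k)) * sph_basis q (loc k)) * sph_basis p \<omega>)"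
        unfolding sum_distrib_right by (rule sum.swap)
      moreover have "sph_basis q \<omega> = (\<Sum>p\<in>band L. of_bool (p = q) * sph_basis p \<omega>)"
        using expand by (rule fun_cong)
      ultimately show ?thesis
        by (simp only: left_diff_distrib sum_subtractf)
    qed
    ultimately show "((\<lambda>A. \<Sum>p\<in>band L. ?C p A * sph_basis p \<omega>) \<longlongrightarrow> 0) (finite_subsets_at_top K)"
      by simp
  qed
  then have "(?C p \<longlongrightarrow> 0) (finite_subsets_at_top K)"
    using p by blast
  from tendsto_add[OF this tendsto_const[of "of_bool (p = q)"]] show ?thesis
    by (simp add: has_sum_def)
qed

text \<open>The functions of one scale, with \<open>a\<close> standing for \<open>sqrt (4 \<pi> / (2 l + 1)) \<kappa>_l\<close>.\<close>

definition scale_fun ::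
    "nat \<Rightarrow> (nat \<times> int \<Rightarrow> complex) \<Rightarrow> ('k \<Rightarrow> real ^ 3) \<Rightarrow> ('k \<Rightarrow> real) \<Rightarrow> 'k \<Rightarrow> real ^ 3 \<Rightarrow> complex" where
  "scale_fun L a loc w k \<omega> =
     (\<Sum>p\<in>band L. (of_real (sqrt (w k)) * a p * sph_basis p (loc k)) * sph_basis p \<omega>)"

lemma scale_fun_in_L2: "scale_fun L a loc w k \<in> L2_space sphere_measure"
  unfolding scale_fun_def[abs_def]
  by (rule L2_orthonormal_sum_space[OF sph_basis_orthonormal_band finite_band])

lemma L2_inner_scale_fun:
  assumes "f \<in> L2_space sphere_measure"
  shows "L2_inner sphere_measure f (scale_fun L a loc w k) =
    (\<Sum>p\<in>band L. cnj (of_real (sqrt (w k)) * a p * sph_basis p (loc k)) * L2_inner sphere_measure f (sph_basis p))"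
  unfolding scale_fun_def[abs_def]
  by (rule L2_orthonormal_inner_sum[OF sph_basis_orthonormal_band finite_band assms])

text \<open>This is the \<open>q\<close>-th Fourier coefficient of
  \<open>\<Sum> <f, \<psi> k> \<psi> k\<close> over one scale. The two square roots combine to the
  weight, and discrete orthogonality leaves only the term \<open>p = q\<close>.\<close>

lemma scale_fun_coefficient_has_sum:
  assumes frame: "scalable_rk_frame L K loc w" and f: "f \<in> L2_space sphere_measure" and q: "q \<in> band L"
  shows "((\<lambda>k. L2_inner sphere_measure f (scale_fun L a loc w k) *
      (of_real (sqrt (w k)) * a q * sph_basis q (loc k))) has_sum
    of_real ((cmod (a q))\<^sup>2) * L2_inner sphere_measure f (sph_basis q)) K"
proof -
  let ?f = "\<lambda>p. L2_inner sphere_measure f (sph_basis p)"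
  have "((\<lambda>k. \<Sum>p\<in>band L. (cnj (a p) * a q * ?f p) *
      (of_real (w k) * cnj (sph_basis p (loc k)) * sph_basis q (loc k))) has_sum
    (\<Sum>p\<in>band L. (cnj (a p) * a q * ?f p) * of_bool (p = q))) K"
    by (intro has_sum_sum has_sum_cmult_right scalable_rk_frame_orthogonality[OF frame _ q])
  also have "(\<Sum>p\<in>band L. (cnj (a p) * a q * ?f p) * of_bool (p = q))
      = (\<Sum>p\<in>band L. if p = q then cnj (a q) * a q * ?f q else 0)"
    by (intro sum.cong) auto
  also have "\<dots> = of_real ((cmod (a q))\<^sup>2) * ?f q"
    using q unfolding complex_norm_square by simp
  finally show ?thesis
  proof (rule has_sum_cong[THEN iffD1, rotated])
    fix k assume "k \<in> K"
    then have "0 \<le> w k"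
      using frame by (auto simp: scalable_rk_frame_def intro: less_imp_le)
    then have w: "of_real (w k) = (of_real (sqrt (w k)) * of_real (sqrt (w k)) :: complex)"
      by (simp flip: of_real_mult)
    show "(\<Sum>p\<in>band L. (cnj (a p) * a q * ?f p) *
        (of_real (w k) * cnj (sph_basis p (loc k)) * sph_basis q (loc k))) =
      L2_inner sphere_measure f (scale_fun L a loc w k) * (of_real (sqrt (w k)) * a q * sph_basis q (loc k))"
      unfolding L2_inner_scale_fun[OF f] sum_distrib_right w by (intro sum.cong) (auto simp: ac_simps)
  qed
qed

text \<open>Expanding only the conjugate factor of \<open>|<f, \<psi> k>|^2\<close> gives a finite
  sum over \<open>q\<close> of the terms in \<open>scale_fun_coefficient_has_sum\<close> times
  \<open>cnj <f, y q>\<close>, so the sum over \<open>k\<close> may be taken term by term.\<close>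

lemma scale_fun_norm_has_sum:
  assumes frame: "scalable_rk_frame L K loc w" and f: "f \<in> L2_space sphere_measure"
  shows "((\<lambda>k. (cmod (L2_inner sphere_measure f (scale_fun L a loc w k)))\<^sup>2) has_sum
    (\<Sum>q\<in>band L. (cmod (a q))\<^sup>2 * (cmod (L2_inner sphere_measure f (sph_basis q)))\<^sup>2)) K"
proof -
  let ?f = "\<lambda>p. L2_inner sphere_measure f (sph_basis p)"
  let ?c = "\<lambda>k. L2_inner sphere_measure f (scale_fun L a loc w k)"
  let ?t = "\<lambda>q k. ?c k * (of_real (sqrt (w k)) * a q * sph_basis q (loc k))"
  have "((\<lambda>k. \<Sum>q\<in>band L. ?t q k * cnj (?f q)) has_sum
      (\<Sum>q\<in>band L. of_real ((cmod (a q))\<^sup>2) * ?f q * cnj (?f q))) K"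
    by (intro has_sum_sum has_sum_cmult_left scale_fun_coefficient_has_sum[OF frame f])
  moreover have "(\<Sum>q\<in>band L. ?t q k * cnj (?f q)) = of_real ((cmod (?c k))\<^sup>2)" for k
  proof -
    have "of_real ((cmod (?c k))\<^sup>2) = ?c k * cnj (?c k)"
      by (rule complex_norm_square)
    also have "cnj (?c k) = (\<Sum>q\<in>band L. (of_real (sqrt (w k)) * a q * sph_basis q (loc k)) * cnj (?f q))"
      unfolding L2_inner_scale_fun[OF f] by simp
    finally show ?thesis
      by (simp only: sum_distrib_left mult.assoc)
  qed
  moreover have "(\<Sum>q\<in>band L. of_real ((cmod (a q))\<^sup>2) * ?f q * cnj (?f q))
      = of_real (\<Sum>q\<in>band L. (cmod (a q))\<^sup>2 * (cmod (?f q))\<^sup>2)"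
    unfolding of_real_sum of_real_mult complex_norm_square[of "?f _"] by (simp only: mult.assoc)
  ultimately show ?thesis
    by (simp only: has_sum_of_real_iff)
qed

text \<open>The frame operator of one scale applied to \<open>f\<close>, as a Fourier multiplier;
  the sampling points have dropped out.\<close>

definition scale_part ::
    "nat \<Rightarrow> (nat \<times> int \<Rightarrow> complex) \<Rightarrow> (real ^ 3 \<Rightarrow> complex) \<Rightarrow> real ^ 3 \<Rightarrow> complex" where
  "scale_part L a f \<omega> =
     (\<Sum>p\<in>band L. (of_real ((cmod (a p))\<^sup>2) * L2_inner sphere_measure f (sph_basis p)) * sph_basis p \<omega>)"

text \<open>All functions lie in the span of one band, where the \<open>L2\<close> norm of the
  remainder is the Euclidean norm of finitely many coefficient errors, each tending to 0.\<close>

lemma scale_part_L2_has_sum: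
  assumes frame: "scalable_rk_frame L K loc w" and f: "f \<in> L2_space sphere_measure"
  shows "L2_has_sum sphere_measure
    (\<lambda>k \<omega>. L2_inner sphere_measure f (scale_fun L a loc w k) * scale_fun L a loc w k \<omega>) K (scale_part L a f)"
proof -
  let ?c = "\<lambda>k. L2_inner sphere_measure f (scale_fun L a loc w k)"
  let ?t = "\<lambda>q A. \<Sum>k\<in>A. ?c k * (of_real (sqrt (w k)) * a q * sph_basis q (loc k))"
  let ?d = "\<lambda>q. of_real ((cmod (a q))\<^sup>2) * L2_inner sphere_measure f (sph_basis q)"
  let ?D = "\<lambda>A \<omega>. scale_part L a f \<omega> - (\<Sum>k\<in>A. ?c k * scale_fun L a loc w k \<omega>)"
  have D: "?D A = (\<lambda>\<omega>. \<Sum>q\<in>band L. (?d q - ?t q A) * sph_basis q \<omega>)" for A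
  proof
    fix \<omega>
    have "(\<Sum>k\<in>A. ?c k * scale_fun L a loc w k \<omega>) = (\<Sum>q\<in>band L. ?t q A * sph_basis q \<omega>)"
      unfolding scale_fun_def[of L a loc w _ \<omega>] sum_distrib_left sum_distrib_right
      by (subst sum.swap) (simp only: mult.assoc)
    then show "?D A \<omega> = (\<Sum>q\<in>band L. (?d q - ?t q A) * sph_basis q \<omega>)"
      unfolding scale_part_def by (simp only: left_diff_distrib sum_subtractf)
  qed
  have norm: "L2_norm sphere_measure (?D A) = sqrt (\<Sum>q\<in>band L. (cmod (?d q - ?t q A))\<^sup>2)" for A
    unfolding D L2_orthonormal_sum_norm[OF sph_basis_orthonormal_band finite_band, symmetric]
    by (simp add: L2_norm_nonneg)
  have "((\<lambda>A. sqrt (\<Sum>q\<in>band L. (cmod (?d q - ?t q A))\<^sup>2)) \<longlongrightarrow>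
      sqrt (\<Sum>q\<in>band L. (cmod (?d q - ?d q))\<^sup>2)) (finite_subsets_at_top K)"
    using scale_fun_coefficient_has_sum[OF frame f, unfolded has_sum_def]
    by (intro tendsto_intros) auto
  then have "((\<lambda>A. L2_norm sphere_measure (?D A)) \<longlongrightarrow> 0) (finite_subsets_at_top K)"
    unfolding norm by simp
  moreover have "scale_part L a f \<in> L2_space sphere_measure"
    unfolding scale_part_def[abs_def]
    by (rule L2_orthonormal_sum_space[OF sph_basis_orthonormal_band finite_band])
  ultimately show ?thesis
    unfolding L2_has_sum_def by (auto intro: L2_space_cmult scale_fun_in_L2)
qed

section \<open>Assembly of the scales\<close>

lemma psi_eq_scale_fun:
  "psi L \<kappa> loc w j k =
    scale_fun (L j) (\<lambda>p. of_real (sqrt (4 * pi / (2 * real (fst p) + 1))) * \<kappa> j (fst p)) (loc j) (w j) k"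
  unfolding psi_def scale_fun_def sum_band sph_basis_def
  by (intro ext sum.cong refl) (simp only: ac_simps)

text \<open>Turns unordered sums over the scales into limits of ordered partial sums.\<close>

lemma filterlim_int_intervals:
  "filterlim (\<lambda>J. {a..J}) (finite_subsets_at_top {a :: int..}) at_top"
  unfolding filterlim_finite_subsets_at_top
proof (intro allI impI)
  fix X assume X: "finite X \<and> X \<subseteq> {a..}"
  then have "\<forall>\<^sub>F J in at_top. \<forall>x\<in>X. x \<le> J"
    by (intro eventually_ball_finite ballI eventually_ge_at_top) auto
  then show "\<forall>\<^sub>F J in at_top. finite {a..J} \<and> X \<subseteq> {a..J} \<and> {a..J} \<subseteq> {a..}"
    by eventually_elim (use X in auto)
qed

text \<open>Tonelli: summing \<open>|a j p|^2 |<f, y p>|^2\<close> over \<open>j\<close> first gives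
  \<open>|<f, y p>|^2\<close> by the partition of unity, then \<open>||f||^2\<close> by Parseval.
  Nonnegativity allows the exchange, and for fixed \<open>j\<close> the sum over \<open>p\<close> is
  finite because \<open>a j\<close> vanishes off its band.\<close>

lemma scale_norms_has_sum:
  fixes a :: "int \<Rightarrow> nat \<times> int \<Rightarrow> complex"
  assumes partition: "\<And>p. p \<in> harmonic_indices \<Longrightarrow> ((\<lambda>j. (cmod (a j p))\<^sup>2) has_sum 1) J"
    and band: "\<And>j p. j \<in> J \<Longrightarrow> p \<in> harmonic_indices \<Longrightarrow> p \<notin> band (L j) \<Longrightarrow> a j p = 0"
    and f: "f \<in> L2_space sphere_measure"
  shows "((\<lambda>j. \<Sum>p\<in>band (L j). (cmod (a j p))\<^sup>2 * (cmod (L2_inner sphere_measure f (sph_basis p)))\<^sup>2)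
    has_sum (L2_norm sphere_measure f)\<^sup>2) J"
proof -
  let ?f = "\<lambda>p. (cmod (L2_inner sphere_measure f (sph_basis p)))\<^sup>2"
  let ?F = "\<lambda>(p, j). (cmod (a j p))\<^sup>2 * ?f p"
  have inner: "((\<lambda>j. ?F (p, j)) has_sum ?f p) J" if "p \<in> harmonic_indices" for p
    using has_sum_cmult_left[OF partition[OF that], of "?f p"] by simp
  note parseval = sph_basis_parseval[OF f]
  have "?F summable_on harmonic_indices \<times> J"
    by (rule summable_on_SigmaI[OF inner has_sum_imp_summable[OF parseval]]) auto
  from has_sum_SigmaI[OF inner parseval this]
  have "((\<lambda>(j, p). ?F (p, j)) has_sum (L2_norm sphere_measure f)\<^sup>2) (J \<times> harmonic_indices)"
    unfolding has_sum_swap[of ?F] by simp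
  then show ?thesis
  proof (rule has_sum_SigmaD)
    fix j assume "j \<in> J"
    then show "((\<lambda>p. case (j, p) of (j, p) \<Rightarrow> ?F (p, j)) has_sum
        (\<Sum>p\<in>band (L j). (cmod (a j p))\<^sup>2 * ?f p)) harmonic_indices"
      by (intro has_sum_finite_neutralI[OF finite_band band_subset_harmonic_indices[of "L j"]])
         (auto simp: band)
  qed
qed

text \<open>The partial sum up to scale \<open>J\<close> is the multiplier
  \<open>s p = \<Sum> |a j p|^2\<close>, which lies in \<open>[0, 1]\<close>. Hence
  \<open>s^2 \<le> s\<close>, and
  \<open>||f||^2 - 2 \<Sum> s |<f, y p>|^2 + \<Sum> s^2 |<f, y p>|^2\<close> is at most
  \<open>||f||^2 - \<Sum> s |<f, y p>|^2\<close>, which tends to 0.\<close>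

lemma scale_parts_limit:
  fixes a :: "int \<Rightarrow> nat \<times> int \<Rightarrow> complex"
  assumes partition: "\<And>p. p \<in> harmonic_indices \<Longrightarrow> ((\<lambda>j. (cmod (a j p))\<^sup>2) has_sum 1) {j0..}"
    and band: "\<And>j p. j0 \<le> j \<Longrightarrow> p \<in> harmonic_indices \<Longrightarrow> p \<notin> band (L j) \<Longrightarrow> a j p = 0"
    and f: "f \<in> L2_space sphere_measure"
  shows "((\<lambda>J. L2_norm sphere_measure (\<lambda>\<omega>. f \<omega> - (\<Sum>j\<in>{j0..J}. scale_part (L j) (a j) f \<omega>))) \<longlongrightarrow> 0) at_top"
proof -
  let ?f = "\<lambda>p. L2_inner sphere_measure f (sph_basis p)"
  let ?S = "\<lambda>j. \<Sum>p\<in>band (L j). (cmod (a j p))\<^sup>2 * (cmod (?f p))\<^sup>2"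
  let ?N = "\<lambda>J. L2_norm sphere_measure (\<lambda>\<omega>. f \<omega> - (\<Sum>j\<in>{j0..J}. scale_part (L j) (a j) f \<omega>))"
  have bound: "(?N J)\<^sup>2 \<le> (L2_norm sphere_measure f)\<^sup>2 - (\<Sum>j\<in>{j0..J}. ?S j)" for J
  proof -
    define P where "P = (\<Union>j\<in>{j0..J}. band (L j))"
    define s where "s p = (\<Sum>j\<in>{j0..J}. (cmod (a j p))\<^sup>2)" for p
    have P: "finite P" "P \<subseteq> harmonic_indices"
      using band_subset_harmonic_indices by (auto simp: P_def)
    \<comment> \<open>The bands of different scales are unrelated, so each sum is extended by zeros
      to their union \<open>P\<close>. The open value type serves both the complex coefficients and
      the real squared norms.\<close>
    have extend: "(\<Sum>p\<in>band (L j). of_real ((cmod (a j p))\<^sup>2) * g p) = (\<Sum>p\<in>P. of_real ((cmod (a j p))\<^sup>2) * g p)"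
      if "j \<in> {j0..J}" for j and g :: "nat \<times> int \<Rightarrow> 'b::real_normed_field"
      using that P by (intro sum.mono_neutral_left) (auto simp: P_def band)
    have s: "0 \<le> s p" "s p \<le> 1" if "p \<in> P" for p
    proof -
      show "s p \<le> 1"
        unfolding s_def using that P
        by (intro has_sum_mono_neutral[OF has_sum_finite partition]) auto
    qed (simp add: s_def sum_nonneg)
    have "(\<Sum>j\<in>{j0..J}. scale_part (L j) (a j) f \<omega>) = (\<Sum>p\<in>P. (of_real (s p) * ?f p) * sph_basis p \<omega>)" for \<omega>
    proof -
      have "(\<Sum>j\<in>{j0..J}. scale_part (L j) (a j) f \<omega>)
          = (\<Sum>j\<in>{j0..J}. \<Sum>p\<in>P. of_real ((cmod (a j p))\<^sup>2) * (?f p * sph_basis p \<omega>))"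
        unfolding scale_part_def mult.assoc by (intro sum.cong refl extend)
      also have "\<dots> = (\<Sum>p\<in>P. \<Sum>j\<in>{j0..J}. of_real ((cmod (a j p))\<^sup>2) * (?f p * sph_basis p \<omega>))"
        by (rule sum.swap)
      finally show ?thesis
        by (simp only: s_def of_real_sum sum_distrib_right mult.assoc)
    qed
    then have "(?N J)\<^sup>2 = (L2_norm sphere_measure f)\<^sup>2
        - 2 * (\<Sum>p\<in>P. Re (cnj (of_real (s p) * ?f p) * ?f p)) + (\<Sum>p\<in>P. (cmod (of_real (s p) * ?f p))\<^sup>2)"
      using L2_orthonormal_diff_norm[OF L2_orthonormal_subset[OF sph_basis_orthonormal P(2)] P(1) f,
          of "\<lambda>p. of_real (s p) * ?f p"] by simp
    also have "(\<Sum>p\<in>P. Re (cnj (of_real (s p) * ?f p) * ?f p)) = (\<Sum>p\<in>P. s p * (cmod (?f p))\<^sup>2)"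
    proof (rule sum.cong)
      fix p
      have "cnj (of_real (s p) * ?f p) * ?f p = of_real (s p) * (cnj (?f p) * ?f p)"
        by simp
      then show "Re (cnj (of_real (s p) * ?f p) * ?f p) = s p * (cmod (?f p))\<^sup>2"
        by (simp only: scaleR_conv_of_real[symmetric] scaleR_complex.sel Re_cnj_mult_self)
    qed simp
    also have "(\<Sum>p\<in>P. (cmod (of_real (s p) * ?f p))\<^sup>2) \<le> (\<Sum>p\<in>P. s p * (cmod (?f p))\<^sup>2)"
    proof (rule sum_mono)
      fix p assume "p \<in> P"
      then have "(s p)\<^sup>2 \<le> s p"
        using s[of p] mult_left_le[of "s p" "s p"] by (simp add: power2_eq_square)
      then show "(cmod (of_real (s p) * ?f p))\<^sup>2 \<le> s p * (cmod (?f p))\<^sup>2"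
        by (simp add: norm_mult power_mult_distrib mult_right_mono)
    qed
    also have "(\<Sum>p\<in>P. s p * (cmod (?f p))\<^sup>2) = (\<Sum>j\<in>{j0..J}. ?S j)"
    proof -
      have "(\<Sum>j\<in>{j0..J}. ?S j) = (\<Sum>j\<in>{j0..J}. \<Sum>p\<in>P. (cmod (a j p))\<^sup>2 * (cmod (?f p))\<^sup>2)"
        by (rule sum.cong[OF refl]) (use extend[of _ "\<lambda>p. (cmod (?f p))\<^sup>2"] in simp)
      also have "\<dots> = (\<Sum>p\<in>P. \<Sum>j\<in>{j0..J}. (cmod (a j p))\<^sup>2 * (cmod (?f p))\<^sup>2)"
        by (rule sum.swap)
      finally show ?thesis
        by (simp only: s_def sum_distrib_right)
    qed
    finally show ?thesis by simp
  qed
  have "(?S has_sum (L2_norm sphere_measure f)\<^sup>2) {j0..}"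
    using partition band f by (intro scale_norms_has_sum) auto
  then have "((\<lambda>J. \<Sum>j\<in>{j0..J}. ?S j) \<longlongrightarrow> (L2_norm sphere_measure f)\<^sup>2) at_top"
    unfolding has_sum_def by (rule filterlim_compose[OF _ filterlim_int_intervals])
  then have "((\<lambda>J. (L2_norm sphere_measure f)\<^sup>2 - (\<Sum>j\<in>{j0..J}. ?S j)) \<longlongrightarrow>
      (L2_norm sphere_measure f)\<^sup>2 - (L2_norm sphere_measure f)\<^sup>2) at_top"
    by (intro tendsto_intros)
  then have lim: "((\<lambda>J. (L2_norm sphere_measure f)\<^sup>2 - (\<Sum>j\<in>{j0..J}. ?S j)) \<longlongrightarrow> 0) at_top"
    by simp
  have "((\<lambda>J. (?N J)\<^sup>2) \<longlongrightarrow> 0) at_top"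
    by (rule tendsto_sandwich[OF _ _ tendsto_const lim]) (auto intro!: always_eventually bound)
  then show ?thesis
    using tendsto_real_sqrt[of "\<lambda>J. (?N J)\<^sup>2" 0] L2_norm_nonneg by simp
qed

text \<open>The double series is read in two ways: unordered over all pairs, and as an ordered limit
  over the scales of inner sums over \<open>K j\<close>. As \<open>K j\<close> may be infinite, the
  inner sums are themselves \<open>L2\<close> limits, and \<open>g j\<close> is a representative of
  their value.\<close>

theorem theorem3p3:
  fixes L :: "int \<Rightarrow> nat"
    and \<kappa> :: "int \<Rightarrow> nat \<Rightarrow> complex"
    and K :: "int \<Rightarrow> 'k set"
    and loc :: "int \<Rightarrow> 'k \<Rightarrow> real ^ 3"
    and w :: "int \<Rightarrow> 'k \<Rightarrow> real"
  assumes bandlimited_window: "\<And>j l. -1 \<le> j \<Longrightarrow> L j < l \<Longrightarrow> \<kappa> j l = 0"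
    and calderon:
      "\<And>l. ((\<lambda>j. 4 * pi / (2 * real l + 1) * (cmod (\<kappa> j l))\<^sup>2) has_sum 1) {-1..}"
    and frames: "\<And>j. -1 \<le> j \<Longrightarrow> scalable_rk_frame (L j) (K j) (loc j) (w j)"
  shows "parseval_tight_frame sphere_measure (SIGMA j:{-1..}. K j) (\<lambda>(j, k). psi L \<kappa> loc w j k) \<and>
    (\<forall>f\<in>L2_space sphere_measure.
      (\<exists>g. (\<forall>j\<ge>-1. L2_has_sum sphere_measure
               (\<lambda>k \<omega>. L2_inner sphere_measure f (psi L \<kappa> loc w j k) * psi L \<kappa> loc w j k \<omega>)
               (K j) (g j)) \<and>
           ((\<lambda>J. L2_norm sphere_measure (\<lambda>\<omega>. f \<omega> - (\<Sum>j\<in>{-1..J}. g j \<omega>))) \<longlongrightarrow> 0) at_top) \<and>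
      (\<forall>j\<ge>-1. (\<lambda>k. (cmod (L2_inner sphere_measure f (psi L \<kappa> loc w j k)))\<^sup>2) summable_on K j) \<and>
      ((\<lambda>j. \<Sum>\<^sub>\<infinity>k\<in>K j. (cmod (L2_inner sphere_measure f (psi L \<kappa> loc w j k)))\<^sup>2)
         has_sum (L2_norm sphere_measure f)\<^sup>2) {-1..})"
proof -
  \<comment> \<open>The square root is placed so that \<open>|a j p|^2\<close> is exactly the
    summand of the Calderon condition.\<close>
  define a where "a = (\<lambda>j p :: nat \<times> int. of_real (sqrt (4 * pi / (2 * real (fst p) + 1))) * \<kappa> j (fst p))"
  have psi: "psi L \<kappa> loc w j k = scale_fun (L j) (a j) (loc j) (w j) k" for j k
    unfolding a_def by (rule psi_eq_scale_fun)
  have a_sq: "(cmod (a j p))\<^sup>2 = 4 * pi / (2 * real (fst p) + 1) * (cmod (\<kappa> j (fst p)))\<^sup>2" for j p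
    by (simp add: a_def norm_mult power_mult_distrib)
  have partition: "((\<lambda>j. (cmod (a j p))\<^sup>2) has_sum 1) {-1..}" for p
    unfolding a_sq by (rule calderon)
  have band: "a j p = 0" if "-1 \<le> j" "p \<in> harmonic_indices" "p \<notin> band (L j)" for j p
    using that bandlimited_window by (simp add: a_def mem_band_iff)
  let ?S = "\<lambda>f j. \<Sum>p\<in>band (L j). (cmod (a j p))\<^sup>2 * (cmod (L2_inner sphere_measure f (sph_basis p)))\<^sup>2"
  let ?F = "\<lambda>f j k. (cmod (L2_inner sphere_measure f (psi L \<kappa> loc w j k)))\<^sup>2"
  have S: "(?S f has_sum (L2_norm sphere_measure f)\<^sup>2) {-1..}" if "f \<in> L2_space sphere_measure" for f
    using partition band that by (intro scale_norms_has_sum) auto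
  have F: "(?F f j has_sum ?S f j) (K j)" if "f \<in> L2_space sphere_measure" "-1 \<le> j" for f j
    unfolding psi by (rule scale_fun_norm_has_sum[OF frames[OF that(2)] that(1)])
  \<comment> \<open>All terms are nonnegative, so convergence of the iterated sums already gives
    unordered summability over the pairs.\<close>
  have F_Sigma: "((\<lambda>(j, k). ?F f j k) has_sum (L2_norm sphere_measure f)\<^sup>2) (SIGMA j:{-1..}. K j)"
    if f: "f \<in> L2_space sphere_measure" for f
  proof (rule has_sum_SigmaI)
    show F': "((\<lambda>k. case (j, k) of (j, k) \<Rightarrow> ?F f j k) has_sum ?S f j) (K j)" if "j \<in> {-1..}" for j
      using F[OF f, of j] that by simp
    show "(?S f has_sum (L2_norm sphere_measure f)\<^sup>2) {-1..}"
      by (rule S[OF f])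
    then show "(\<lambda>(j, k). ?F f j k) summable_on (SIGMA j:{-1..}. K j)"
      by (intro summable_on_SigmaI[OF F' has_sum_imp_summable]) auto
  qed
  have "parseval_tight_frame sphere_measure (SIGMA j:{-1..}. K j) (\<lambda>(j, k). psi L \<kappa> loc w j k)"
    by (rule parseval_tight_frameI)
       (use F_Sigma in \<open>auto simp: psi scale_fun_in_L2 case_prod_unfold\<close>)
  moreover have "\<exists>g. (\<forall>j\<ge>-1. L2_has_sum sphere_measure
        (\<lambda>k \<omega>. L2_inner sphere_measure f (psi L \<kappa> loc w j k) * psi L \<kappa> loc w j k \<omega>) (K j) (g j)) \<and>
      ((\<lambda>J. L2_norm sphere_measure (\<lambda>\<omega>. f \<omega> - (\<Sum>j\<in>{-1..J}. g j \<omega>))) \<longlongrightarrow> 0) at_top"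
    if f: "f \<in> L2_space sphere_measure" for f
  proof (intro exI[of _ "\<lambda>j. scale_part (L j) (a j) f"] conjI allI impI)
    show "L2_has_sum sphere_measure
        (\<lambda>k \<omega>. L2_inner sphere_measure f (psi L \<kappa> loc w j k) * psi L \<kappa> loc w j k \<omega>) (K j)
        (scale_part (L j) (a j) f)" if "-1 \<le> j" for j
      unfolding psi by (rule scale_part_L2_has_sum[OF frames[OF that] f])
    show "((\<lambda>J. L2_norm sphere_measure (\<lambda>\<omega>. f \<omega> - (\<Sum>j\<in>{-1..J}. scale_part (L j) (a j) f \<omega>))) \<longlongrightarrow> 0) at_top"
      using partition band f by (intro scale_parts_limit) auto
  qed
  moreover have "?F f j summable_on K j" if "f \<in> L2_space sphere_measure" "-1 \<le> j" for f j
    using F[OF that] by (rule has_sum_imp_summable)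
  moreover have "((\<lambda>j. \<Sum>\<^sub>\<infinity>k\<in>K j. ?F f j k) has_sum (L2_norm sphere_measure f)\<^sup>2) {-1..}"
    if "f \<in> L2_space sphere_measure" for f
    using S[OF that] by (rule has_sum_cong[THEN iffD1, rotated]) (use infsumI[OF F[OF that]] in auto)
  ultimately show ?thesis
    by blast
qed

end
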